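(* Let $G\le\Gamma$ be a normal subgroup of finite index whose modular curve has genus $g$, let $\{f_1,\ldots,f_g\}$ be a basis of $S_2(G)$, and let $\rho_0:\Gamma\to\mathrm{GL}_g(\mathbb{C})$ be the representation given by the weight-two slash action on this basis, i.e. $F_0=(f_1,\ldots,f_g)^t$ satisfies $F_0|_2\gamma=\rho_0(\gamma)F_0$ for all $\gamma\in\Gamma$. For $1\le k\le g$ put $u_k(\tau)=\int_{i\infty}^{\tau}f_k(z)\,dz$ and $F=(u_1,\ldots,u_g,1)^t$. Then $F$ is a holomorphic vector-valued modular function for an indecomposable representation $\rho:\Gamma\to\mathrm{GL}_{g+1}(\mathbb{C})$ (i.e. $F(\gamma\tau)=\rho(\gamma)F(\tau)$ for all $\gamma\in\Gamma$) which fits in an exact sequence $0\to\rho_0\to\rho\to1\to0$ (with $\rho_0$ the subrepresentation on the first $g$ coordinates and trivial quotient), and $\rho(T)$ is diagonalizable.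
   Context: $\Gamma=\mathrm{PSL}_2(\mathbb{Z})$, $T$ the image of $\begin{pmatrix}1&1\\0&1\end{pmatrix}$, $\mathbb{H}$ the upper half-plane. $S_2(G)$ is the space of weight two cusp forms for $G$. The slash action is $f|_2\gamma(\tau)=f\!\left(\frac{a\tau+b}{c\tau+d}\right)(c\tau+d)^{-2}$, applied componentwise. A holomorphic vector-valued modular function for $\rho$ is a holomorphic $F:\mathbb{H}\to\mathbb{C}^{g+1}$ with $F(\gamma\tau)=\rho(\gamma)F(\tau)$ for all $\gamma\in\Gamma$ that is holomorphic at the cusp, i.e. $e^{-2\pi i\tau L}F(\tau)$ extends holomorphically to $q=e^{2\pi i\tau}=0$, where $L$ is the unique matrix with $e^{2\pi iL}=\rho(T)$ whose eigenvalues have real parts in $[0,1)$. *)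

theory Defs
  imports
    "HOL-Complex_Analysis.Complex_Analysis"
    "HOL-Homology.Homology"
    "HOL-Algebra.Free_Abelian_Groups"
    "Jordan_Normal_Form.VS_Connect"
    "Jordan_Normal_Form.Char_Poly"
    "Jordan_Normal_Form.Matrix_Kernel"
begin

unbundle no vec_syntax
hide_const (open) Finite_Cartesian_Product.vec Finite_Cartesian_Product.mat
  Determinants.det

section \<open>The modular group\<close>

definition SL2Z :: "int mat monoid" where
  "SL2Z = \<lparr>carrier = {A \<in> carrier_mat 2 2. det A = 1}, mult = (*), one = 1\<^sub>m 2\<rparr>"

definition PSL2Z :: "int mat set monoid" where
  "PSL2Z = SL2Z Mod {1\<^sub>m 2, - 1\<^sub>m 2}"

text \<open>The image in \<open>PSL2Z\<close> of a matrix, i.e. its class modulo sign. Actions of the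
  modular group are written on matrices; all of them are invariant under a change of sign.\<close>

definition psl :: "int mat \<Rightarrow> int mat set" where
  "psl A = {1\<^sub>m 2, - 1\<^sub>m 2} #>\<^bsub>SL2Z\<^esub> A"

definition psl_T :: "int mat set" where
  "psl_T = psl (mat_of_rows_list 2 [[1, 1], [0, 1]])"

definition uhp :: "complex set" where
  "uhp = {\<tau>. 0 < Im \<tau>}"

definition moebius :: "int mat \<Rightarrow> complex \<Rightarrow> complex" where
  "moebius A \<tau> = (of_int (A $$ (0,0)) * \<tau> + of_int (A $$ (0,1)))
                / (of_int (A $$ (1,0)) * \<tau> + of_int (A $$ (1,1)))"

definition slash2 :: "(complex \<Rightarrow> complex) \<Rightarrow> int mat \<Rightarrow> complex \<Rightarrow> complex" where
  "slash2 f A \<tau> = f (moebius A \<tau>) / (of_int (A $$ (1,0)) * \<tau> + of_int (A $$ (1,1)))\<^sup>2"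

lemma det_2x2_entries:
  fixes A :: "int mat"
  assumes "A \<in> carrier_mat 2 2"
  shows "det A = A $$ (0,0) * A $$ (1,1) - A $$ (0,1) * A $$ (1,0)"
proof -
  have "det A = (\<Sum>i<2. A $$ (i,0) * cofactor A i 0)"
    using laplace_expansion_column[OF assms, of 0] by simp
  then have "det A = A $$ (0,0) * cofactor A 0 0 + A $$ (1,0) * cofactor A 1 0"
    by (simp add: numeral_2_eq_2)
  moreover have "cofactor A 0 0 = A $$ (1,1)" "cofactor A 1 0 = - A $$ (0,1)"
    using assms by (auto simp: cofactor_def mat_delete_def det_single)
  ultimately show ?thesis by simp
qed

lemma group_SL2Z: "group SL2Z"
proof (rule groupI)
  fix A assume "A \<in> carrier SL2Z"
  then have A: "A \<in> carrier_mat 2 2" "det A = 1" by (auto simp: SL2Z_def)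
  have "det (adj_mat A) * det A = det (adj_mat A * A)"
    using A adj_mat(1)[OF A(1)] by (simp add: det_mult)
  also have "\<dots> = 1" using A adj_mat(3)[OF A(1)] by simp
  finally have "det (adj_mat A) = 1" using A by simp
  with A adj_mat[OF A(1)] show "\<exists>B\<in>carrier SL2Z. B \<otimes>\<^bsub>SL2Z\<^esub> A = \<one>\<^bsub>SL2Z\<^esub>"
    by (intro bexI[of _ "adj_mat A"]) (auto simp: SL2Z_def)
qed (auto simp: SL2Z_def det_mult)

lemma normal_SL2Z_sign: "{1\<^sub>m 2, - 1\<^sub>m 2} \<lhd> SL2Z"
proof -
  interpret group SL2Z by (rule group_SL2Z)
  have det_m1: "det (- 1\<^sub>m 2 :: int mat) = 1"
    using det_2x2_entries[of "- 1\<^sub>m 2 :: int mat"] by simp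
  have m1: "- 1\<^sub>m 2 \<in> carrier SL2Z"
    using det_m1 by (auto simp: SL2Z_def)
  have sq: "- 1\<^sub>m 2 * - 1\<^sub>m 2 = (1\<^sub>m 2 :: int mat)"
    by simp
  have inv_m1: "inv\<^bsub>SL2Z\<^esub> (- 1\<^sub>m 2) = - 1\<^sub>m 2"
    by (rule inv_equality) (use sq m1 in \<open>auto simp: SL2Z_def\<close>)
  have inv_1: "inv\<^bsub>SL2Z\<^esub> (1\<^sub>m 2) = 1\<^sub>m 2"
    using inv_one by (simp add: SL2Z_def)
  have sub: "subgroup {1\<^sub>m 2, - 1\<^sub>m 2} SL2Z"
    by (rule subgroupI) (use m1 inv_m1 inv_1 sq in \<open>auto simp: SL2Z_def\<close>)
  have comm: "A \<otimes>\<^bsub>SL2Z\<^esub> h = h \<otimes>\<^bsub>SL2Z\<^esub> A"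
    if "A \<in> carrier SL2Z" "h \<in> {1\<^sub>m 2, - 1\<^sub>m 2}" for A h
    using that by (auto simp: SL2Z_def)
  show ?thesis
    unfolding normal_inv_iff
  proof (intro conjI ballI sub)
    fix A h assume A: "A \<in> carrier SL2Z" and h: "h \<in> {1\<^sub>m 2, - 1\<^sub>m 2 :: int mat}"
    have hc: "h \<in> carrier SL2Z" using h m1 by (auto simp: SL2Z_def)
    have "A \<otimes>\<^bsub>SL2Z\<^esub> h \<otimes>\<^bsub>SL2Z\<^esub> inv\<^bsub>SL2Z\<^esub> A = h"
      using comm[OF A h] A hc by (simp add: m_assoc)
    with h show "A \<otimes>\<^bsub>SL2Z\<^esub> h \<otimes>\<^bsub>SL2Z\<^esub> inv\<^bsub>SL2Z\<^esub> A \<in> {1\<^sub>m 2, - 1\<^sub>m 2}" by simp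
  qed
qed

lemma group_PSL2Z: "group PSL2Z"
  unfolding PSL2Z_def by (rule normal.factorgroup_is_group[OF normal_SL2Z_sign])

lemma moebius_uhp:
  assumes "A \<in> carrier SL2Z" "\<tau> \<in> uhp"
  shows "moebius A \<tau> \<in> uhp"
proof -
  define a b c d where "a = real_of_int (A $$ (0,0))" "b = real_of_int (A $$ (0,1))"
    "c = real_of_int (A $$ (1,0))" "d = real_of_int (A $$ (1,1))"
  have A: "A \<in> carrier_mat 2 2" "det A = 1" using assms by (auto simp: SL2Z_def)
  have "of_int (det A) = a * d - b * c"
    unfolding a_b_c_d_def det_2x2_entries[OF A(1)] by simp
  with A have ad: "a * d - b * c = 1" by simp
  have t: "Im \<tau> > 0" using assms by (simp add: uhp_def)
  have m: "moebius A \<tau> = (of_real a * \<tau> + of_real b) / (of_real c * \<tau> + of_real d)"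
    by (simp add: moebius_def a_b_c_d_def)
  have nz: "(c * Re \<tau> + d)\<^sup>2 + (c * Im \<tau>)\<^sup>2 > 0"
  proof (cases "c = 0")
    case True
    with ad have "d \<noteq> 0" by auto
    with True show ?thesis by simp
  next
    case False
    with t have "c * Im \<tau> \<noteq> 0" by simp
    then show ?thesis by (simp add: add_nonneg_pos)
  qed
  have "Im (moebius A \<tau>) = (a * d - b * c) * Im \<tau> / ((c * Re \<tau> + d)\<^sup>2 + (c * Im \<tau>)\<^sup>2)"
    unfolding m Im_divide by (simp add: algebra_simps)
  then show ?thesis using nz t ad by (simp add: uhp_def)
qed

section \<open>Modular curves and their genus\<close>

text \<open>The extended upper half-plane: \<open>None\<close> is the cusp at infinity.\<close>

definition uhp_ext :: "complex option set" where
  "uhp_ext = Some ` uhp \<union> Some ` \<rat> \<union> {None}"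

definition moebius_ext :: "int mat \<Rightarrow> complex option \<Rightarrow> complex option" where
  "moebius_ext A p =
     (case p of
        None \<Rightarrow> if A $$ (1,0) = 0 then None
                else Some (of_int (A $$ (0,0)) / of_int (A $$ (1,0)))
      | Some z \<Rightarrow> if of_int (A $$ (1,0)) * z + of_int (A $$ (1,1)) = 0 then None
                  else Some (moebius A z))"

text \<open>The usual horoball topology: a neighbourhood of the cusp \<open>\<gamma> \<infinity>\<close> contains the
  translate by \<open>\<gamma>\<close> of some half-plane \<open>Im z > Y\<close>.\<close>

definition open_uhp_ext :: "complex option set \<Rightarrow> bool" where
  "open_uhp_ext U \<longleftrightarrow> U \<subseteq> uhp_ext \<and> open {z \<in> uhp. Some z \<in> U} \<and>
     (\<forall>A\<in>carrier SL2Z. moebius_ext A None \<in> U \<longrightarrow>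
        (\<exists>Y>0. \<forall>z. Im z > Y \<longrightarrow> Some (moebius A z) \<in> U))"

definition uhp_ext_top :: "complex option topology" where
  "uhp_ext_top = topology open_uhp_ext"

lemma istopology_open_uhp_ext: "istopology open_uhp_ext"
  unfolding istopology_def
proof (intro conjI allI impI)
  fix S T assume S: "open_uhp_ext S" and T: "open_uhp_ext T"
  have eq: "{z \<in> uhp. Some z \<in> S \<inter> T} = {z \<in> uhp. Some z \<in> S} \<inter> {z \<in> uhp. Some z \<in> T}"
    by auto
  have "\<exists>Y>0. \<forall>z. Im z > Y \<longrightarrow> Some (moebius A z) \<in> S \<inter> T"
    if A: "A \<in> carrier SL2Z" "moebius_ext A None \<in> S \<inter> T" for A
  proof -
    obtain Y1 Y2 where "Y1 > 0" "\<forall>z. Im z > Y1 \<longrightarrow> Some (moebius A z) \<in> S"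
      "Y2 > 0" "\<forall>z. Im z > Y2 \<longrightarrow> Some (moebius A z) \<in> T"
      using S T A unfolding open_uhp_ext_def by blast
    then show ?thesis by (intro exI[of _ "max Y1 Y2"]) auto
  qed
  with S T show "open_uhp_ext (S \<inter> T)"
    unfolding open_uhp_ext_def eq by (auto intro: open_Int)
next
  fix K assume K: "\<forall>S\<in>K. open_uhp_ext S"
  have eq: "{z \<in> uhp. Some z \<in> \<Union>K} = (\<Union>S\<in>K. {z \<in> uhp. Some z \<in> S})" by auto
  have "\<exists>Y>0. \<forall>z. Im z > Y \<longrightarrow> Some (moebius A z) \<in> \<Union>K"
    if A: "A \<in> carrier SL2Z" "moebius_ext A None \<in> \<Union>K" for A
  proof -
    obtain S where S: "S \<in> K" "moebius_ext A None \<in> S" using A by blast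
    then obtain Y where "Y > 0" "\<forall>z. Im z > Y \<longrightarrow> Some (moebius A z) \<in> S"
      using K A unfolding open_uhp_ext_def by blast
    with S show ?thesis by blast
  qed
  moreover have "open {z \<in> uhp. Some z \<in> \<Union>K}"
    unfolding eq using K by (auto simp: open_uhp_ext_def)
  moreover have "\<Union>K \<subseteq> uhp_ext" using K by (auto simp: open_uhp_ext_def)
  ultimately show "open_uhp_ext (\<Union>K)" by (simp add: open_uhp_ext_def)
qed

lemma openin_uhp_ext_top: "openin uhp_ext_top U \<longleftrightarrow> open_uhp_ext U"
  unfolding uhp_ext_top_def using istopology_open_uhp_ext by (simp add: topology_inverse')

lemma topspace_uhp_ext_top: "topspace uhp_ext_top = uhp_ext"
proof -
  have "{z \<in> uhp. Some z \<in> uhp_ext} = uhp" by (auto simp: uhp_ext_def)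
  moreover have "open uhp" unfolding uhp_def by (rule open_halfspace_Im_gt)
  ultimately have "open_uhp_ext uhp_ext"
    using moebius_uhp by (auto simp: open_uhp_ext_def uhp_ext_def uhp_def intro!: exI[of _ 1])
  then show ?thesis
    unfolding topspace_def openin_uhp_ext_top by (auto simp: open_uhp_ext_def)
qed

definition orbit_ext :: "int mat set set \<Rightarrow> complex option \<Rightarrow> complex option set" where
  "orbit_ext G p = {moebius_ext A p | A. A \<in> carrier SL2Z \<and> psl A \<in> G}"

text \<open>The compact modular curve of \<open>G\<close>, as a topological quotient.\<close>

definition open_modular_curve :: "int mat set set \<Rightarrow> complex option set set \<Rightarrow> bool" where
  "open_modular_curve G V \<longleftrightarrow> V \<subseteq> orbit_ext G ` uhp_ext \<and>
     openin uhp_ext_top {p \<in> uhp_ext. orbit_ext G p \<in> V}"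

definition modular_curve :: "int mat set set \<Rightarrow> complex option set topology" where
  "modular_curve G = topology (open_modular_curve G)"

lemma istopology_open_modular_curve: "istopology (open_modular_curve G)"
  unfolding istopology_def
proof (intro conjI allI impI)
  fix S T assume ST: "open_modular_curve G S" "open_modular_curve G T"
  have "{p \<in> uhp_ext. orbit_ext G p \<in> S \<inter> T} =
        {p \<in> uhp_ext. orbit_ext G p \<in> S} \<inter> {p \<in> uhp_ext. orbit_ext G p \<in> T}" by auto
  with ST show "open_modular_curve G (S \<inter> T)"
    by (auto simp: open_modular_curve_def)
next
  fix K assume K: "\<forall>S\<in>K. open_modular_curve G S"
  have "{p \<in> uhp_ext. orbit_ext G p \<in> \<Union>K} = (\<Union>S\<in>K. {p \<in> uhp_ext. orbit_ext G p \<in> S})"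
    by auto
  with K show "open_modular_curve G (\<Union>K)"
    unfolding open_modular_curve_def by auto
qed

lemma quotient_map_modular_curve:
  "quotient_map uhp_ext_top (modular_curve G) (orbit_ext G)"
proof -
  have op: "openin (modular_curve G) V \<longleftrightarrow> open_modular_curve G V" for V
    unfolding modular_curve_def
    using istopology_open_modular_curve by (simp add: topology_inverse')
  have "{p \<in> uhp_ext. orbit_ext G p \<in> orbit_ext G ` uhp_ext} = topspace uhp_ext_top"
    by (auto simp: topspace_uhp_ext_top)
  then have "open_modular_curve G (orbit_ext G ` uhp_ext)"
    by (simp add: open_modular_curve_def)
  then have "topspace (modular_curve G) = orbit_ext G ` uhp_ext"
    unfolding topspace_def op by (auto simp: open_modular_curve_def)
  then show ?thesis
    by (auto simp: quotient_map_def topspace_uhp_ext_top op open_modular_curve_def)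
qed

text \<open>A closed orientable surface has genus \<open>g\<close> iff its first integral homology is free of
  rank \<open>2 g\<close>.\<close>

definition has_genus :: "'a topology \<Rightarrow> nat \<Rightarrow> bool" where
  "has_genus X g \<longleftrightarrow> homology_group 1 X \<cong> free_Abelian_group {..<2 * g}"

section \<open>Cusp forms of weight two\<close>

text \<open>Cuspidality at every cusp: for each \<open>A\<close> the form \<open>f|A\<close> has an expansion in
  \<open>exp (2 \<pi> i \<tau> / N)\<close> with vanishing constant term. Functions are only
  considered on \<open>uhp\<close>; values elsewhere are irrelevant.\<close>

definition cusp_form2 :: "int mat set set \<Rightarrow> (complex \<Rightarrow> complex) \<Rightarrow> bool" where
  "cusp_form2 G f \<longleftrightarrow> f holomorphic_on uhp \<and>
     (\<forall>A\<in>carrier SL2Z. psl A \<in> G \<longrightarrow> (\<forall>\<tau>\<in>uhp. slash2 f A \<tau> = f \<tau>)) \<and>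
     (\<forall>A\<in>carrier SL2Z. \<exists>N>0. \<exists>h. h holomorphic_on ball 0 1 \<and> h 0 = 0 \<and>
        (\<forall>\<tau>\<in>uhp. slash2 f A \<tau> = h (exp (2 * of_real pi * \<i> * \<tau> / of_nat N))))"

text \<open>The basis elements are \<open>f 0, \<dots>, f (g - 1)\<close>.\<close>

definition cusp_form2_basis :: "int mat set set \<Rightarrow> nat \<Rightarrow> (nat \<Rightarrow> complex \<Rightarrow> complex) \<Rightarrow> bool" where
  "cusp_form2_basis G g f \<longleftrightarrow>
     (\<forall>k<g. cusp_form2 G (f k)) \<and>
     (\<forall>c. (\<forall>\<tau>\<in>uhp. (\<Sum>k<g. c k * f k \<tau>) = 0) \<longrightarrow> (\<forall>k<g. c k = 0)) \<and>
     (\<forall>h. cusp_form2 G h \<longrightarrow> (\<exists>c. \<forall>\<tau>\<in>uhp. h \<tau> = (\<Sum>k<g. c k * f k \<tau>)))"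

text \<open>The integral from \<open>i \<infinity>\<close> to \<open>\<tau>\<close>, as the limit of integrals from \<open>i Y\<close>
  for \<open>Y\<close> tending to infinity.\<close>

definition integral_from_cusp :: "(complex \<Rightarrow> complex) \<Rightarrow> complex \<Rightarrow> complex" where
  "integral_from_cusp f \<tau> =
     Lim at_top (\<lambda>Y::real. contour_integral (linepath (\<i> * of_real Y) \<tau>) f)"

section \<open>Representations of the modular group\<close>

definition GL :: "nat \<Rightarrow> complex mat monoid" where
  "GL n = units_of (ring_mat TYPE(complex) n ())"

definition is_rep :: "nat \<Rightarrow> (int mat set \<Rightarrow> complex mat) \<Rightarrow> bool" where
  "is_rep n \<rho> \<longleftrightarrow> \<rho> \<in> hom PSL2Z (GL n)"

definition trivial_rep :: "int mat set \<Rightarrow> complex mat" where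
  "trivial_rep x = 1\<^sub>m 1"

definition invariant_subspace ::
    "nat \<Rightarrow> (int mat set \<Rightarrow> complex mat) \<Rightarrow> complex vec set \<Rightarrow> bool" where
  "invariant_subspace n \<rho> W \<longleftrightarrow>
     VectorSpace.subspace class_ring W (module_vec TYPE(complex) n) \<and>
     (\<forall>x\<in>carrier PSL2Z. \<forall>w\<in>W. \<rho> x *\<^sub>v w \<in> W)"

definition indecomposable :: "nat \<Rightarrow> (int mat set \<Rightarrow> complex mat) \<Rightarrow> bool" where
  "indecomposable n \<rho> \<longleftrightarrow> n > 0 \<and>
     \<not> (\<exists>U W. invariant_subspace n \<rho> U \<and> invariant_subspace n \<rho> W \<and>
           U \<noteq> {0\<^sub>v n} \<and> W \<noteq> {0\<^sub>v n} \<and>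
           U \<inter> W = {0\<^sub>v n} \<and> {u + w | u w. u \<in> U \<and> w \<in> W} = carrier_vec n)"

definition intertwines ::
    "nat \<Rightarrow> nat \<Rightarrow> (int mat set \<Rightarrow> complex mat) \<Rightarrow> (int mat set \<Rightarrow> complex mat) \<Rightarrow> complex mat \<Rightarrow> bool"
  where
  "intertwines m n \<rho> \<sigma> M \<longleftrightarrow> M \<in> carrier_mat n m \<and> (\<forall>x\<in>carrier PSL2Z. M * \<rho> x = \<sigma> x * M)"

text \<open>Exactness of \<open>0 \<rightarrow> \<rho>1 \<rightarrow> \<rho>2 \<rightarrow> \<rho>3 \<rightarrow> 0\<close> with maps given by the
  matrices \<open>M\<close> and \<open>N\<close>.\<close>

definition short_exact ::
    "nat \<Rightarrow> (int mat set \<Rightarrow> complex mat) \<Rightarrow> complex mat \<Rightarrow> nat \<Rightarrow> (int mat set \<Rightarrow> complex mat) \<Rightarrow>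
     complex mat \<Rightarrow> nat \<Rightarrow> (int mat set \<Rightarrow> complex mat) \<Rightarrow> bool" where
  "short_exact n1 \<rho>1 M n2 \<rho>2 N n3 \<rho>3 \<longleftrightarrow>
     intertwines n1 n2 \<rho>1 \<rho>2 M \<and> intertwines n2 n3 \<rho>2 \<rho>3 N \<and>
     inj_on ((*\<^sub>v) M) (carrier_vec n1) \<and>
     (*\<^sub>v) M ` carrier_vec n1 = mat_kernel N \<and>
     (*\<^sub>v) N ` carrier_vec n2 = carrier_vec n3"

definition incl_first :: "nat \<Rightarrow> complex mat" where
  "incl_first g = Matrix.mat (g + 1) g (\<lambda>(i, j). if i = j then 1 else 0)"

definition proj_last :: "nat \<Rightarrow> complex mat" where
  "proj_last g = Matrix.mat 1 (g + 1) (\<lambda>(i, j). if j = g then 1 else 0)"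

definition diagonalizable_mat :: "complex mat \<Rightarrow> bool" where
  "diagonalizable_mat A \<longleftrightarrow> (\<exists>D. diagonal_mat D \<and> similar_mat A D)"

section \<open>Vector-valued modular functions\<close>

definition mat_exp :: "complex mat \<Rightarrow> complex mat" where
  "mat_exp A = Matrix.mat (dim_row A) (dim_row A)
     (\<lambda>ij. suminf (\<lambda>k. (A ^\<^sub>m k) $$ ij / fact k))"

definition exponent_matrix :: "nat \<Rightarrow> complex mat \<Rightarrow> complex mat \<Rightarrow> bool" where
  "exponent_matrix n R L \<longleftrightarrow> L \<in> carrier_mat n n \<and>
     mat_exp ((2 * of_real pi * \<i>) \<cdot>\<^sub>m L) = R \<and>
     (\<forall>z. eigenvalue L z \<longrightarrow> 0 \<le> Re z \<and> Re z < 1)"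

text \<open>For invertible \<open>R\<close> there is exactly one exponent matrix, so the existential quantifier
  below merely names it.\<close>

definition holomorphic_at_cusp ::
    "nat \<Rightarrow> (int mat set \<Rightarrow> complex mat) \<Rightarrow> (complex \<Rightarrow> complex vec) \<Rightarrow> bool" where
  "holomorphic_at_cusp n \<rho> F \<longleftrightarrow>
     (\<exists>L. exponent_matrix n (\<rho> psl_T) L \<and>
        (\<forall>i<n. \<exists>h. h holomorphic_on ball 0 1 \<and>
           (\<forall>\<tau>\<in>uhp. h (exp (2 * of_real pi * \<i> * \<tau>)) =
              (mat_exp ((- (2 * of_real pi * \<i> * \<tau>)) \<cdot>\<^sub>m L) *\<^sub>v F \<tau>) $ i)))"

definition holomorphic_vvmf ::
    "nat \<Rightarrow> (int mat set \<Rightarrow> complex mat) \<Rightarrow> (complex \<Rightarrow> complex vec) \<Rightarrow> bool" where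
  "holomorphic_vvmf n \<rho> F \<longleftrightarrow>
     (\<forall>\<tau>\<in>uhp. F \<tau> \<in> carrier_vec n) \<and>
     (\<forall>i<n. (\<lambda>\<tau>. F \<tau> $ i) holomorphic_on uhp) \<and>
     (\<forall>A\<in>carrier SL2Z. \<forall>\<tau>\<in>uhp. F (moebius A \<tau>) = \<rho> (psl A) *\<^sub>v F \<tau>) \<and>
     holomorphic_at_cusp n \<rho> F"

end

theory Submission
  imports
    Defs
    "HOL-Analysis.Kronecker_Approximation_Theorem"
    "Jordan_Normal_Form.Jordan_Normal_Form_Existence"
begin

text \<open>
  Each \<open>u\<^sub>k\<close> is a power series in \<open>q\<^sub>N = exp (2 \<pi> i \<tau> / N)\<close> with derivative \<open>f\<^sub>k\<close>, so
  \<open>u \<circ> \<gamma>\<close> and \<open>\<rho>\<^sub>0(\<gamma>) u\<close> differ by a vector of constants. These constants form the last column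
  of \<open>\<rho>(\<gamma>)\<close>, and linear independence of \<open>u\<^sub>1, \<dots>, u\<^sub>g, 1\<close> makes \<open>\<rho>\<close> a homomorphism. Since \<open>F\<close> is
  periodic with period \<open>N\<close>, \<open>\<rho>(T)\<close> has finite order, hence is diagonalizable, and on each eigenvector
  the expansion of \<open>F\<close> in \<open>q\<^sub>N\<close> only involves exponents in one residue class modulo \<open>N\<close>.

  For indecomposability, let \<open>U \<oplus> W\<close> be an invariant decomposition in which \<open>U\<close> maps onto the trivial
  quotient. On \<open>G\<close> the matrices \<open>\<rho>(\<gamma>)\<close> are unipotent and \<open>U\<close> contains all their period vectors, so
  the projection of \<open>F\<close> to \<open>W\<close> is \<open>G\<close>-invariant. As \<open>G\<close> has finite index, the maximum principle makes
  it constant, and independence forces \<open>W = 0\<close>.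
\<close>

no_notation fps_nth (infixl \<open>$\<close> 75)

section \<open>The action of the modular group\<close>

lemma SL2Z_iff: "A \<in> carrier SL2Z \<longleftrightarrow>
    A \<in> carrier_mat 2 2 \<and> A $$ (0,0) * A $$ (1,1) - A $$ (0,1) * A $$ (1,0) = 1"
  by (auto simp: SL2Z_def det_2x2_entries)

lemma one_SL2Z: "1\<^sub>m 2 \<in> carrier SL2Z"
  by (simp add: SL2Z_iff)

lemma mult_SL2Z: "A \<in> carrier SL2Z \<Longrightarrow> B \<in> carrier SL2Z \<Longrightarrow> A * B \<in> carrier SL2Z"
  by (auto simp: SL2Z_def det_mult)

lemma SL2Z_inverse:
  assumes "A \<in> carrier SL2Z"
  obtains B where "B \<in> carrier SL2Z" "B * A = 1\<^sub>m 2" "A * B = 1\<^sub>m 2"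
proof -
  interpret group SL2Z by (rule group_SL2Z)
  show thesis
    using that[of "inv\<^bsub>SL2Z\<^esub> A"] assms l_inv[OF assms] r_inv[OF assms] inv_closed[OF assms]
    by (simp add: SL2Z_def)
qed

lemma SL2Z_denominator_nonzero:
  assumes "A \<in> carrier SL2Z" "\<tau> \<in> uhp"
  shows "of_int (A $$ (1,0)) * \<tau> + of_int (A $$ (1,1)) \<noteq> 0"
proof
  assume 0: "of_int (A $$ (1,0)) * \<tau> + of_int (A $$ (1,1)) = 0"
  then have "Im (of_int (A $$ (1,0)) * \<tau> + of_int (A $$ (1,1))) = 0" by simp
  then have c: "A $$ (1,0) = 0" using assms(2) by (simp add: uhp_def)
  with 0 have "A $$ (1,1) = 0" by simp
  with c assms(1) show False by (simp add: SL2Z_iff)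
qed

lemma mat_2x2_mult_index:
  assumes "A \<in> carrier_mat 2 2" "B \<in> carrier_mat 2 2" "i < 2" "j < 2"
  shows "(A * B) $$ (i,j) = A $$ (i,0) * B $$ (0,j) + A $$ (i,1) * B $$ (1,j)"
  using assms by (simp add: scalar_prod_def numeral_2_eq_2)

lemma moebius_mult:
  assumes A: "A \<in> carrier SL2Z" and B: "B \<in> carrier SL2Z" and \<tau>: "\<tau> \<in> uhp"
  shows "moebius (A * B) \<tau> = moebius A (moebius B \<tau>)"
proof -
  have c: "A \<in> carrier_mat 2 2" "B \<in> carrier_mat 2 2" using A B by (auto simp: SL2Z_iff)
  note nz = SL2Z_denominator_nonzero[OF B \<tau>]
    SL2Z_denominator_nonzero[OF A moebius_uhp[OF B \<tau>]]
    SL2Z_denominator_nonzero[OF mult_SL2Z[OF A B] \<tau>]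
  note idx = mat_2x2_mult_index[OF c]
  define a b c d where abcd: "a = complex_of_int (A $$ (0,0))" "b = complex_of_int (A $$ (0,1))"
    "c = complex_of_int (A $$ (1,0))" "d = complex_of_int (A $$ (1,1))"
  define p q where pq: "p = of_int (B $$ (0,0)) * \<tau> + of_int (B $$ (0,1))"
    "q = of_int (B $$ (1,0)) * \<tau> + of_int (B $$ (1,1))"
  have B\<tau>: "moebius B \<tau> = p / q" by (simp add: moebius_def pq)
  have q: "q \<noteq> 0" using nz(1) by (simp add: pq)
  have r: "c * (p / q) + d \<noteq> 0" using nz(2) unfolding B\<tau> abcd .
  have "moebius (A * B) \<tau> = (a * p + b * q) / (c * p + d * q)"
    by (simp add: moebius_def idx abcd pq algebra_simps)
  also have "\<dots> = (a * (p / q) + b) / (c * (p / q) + d)"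
  proof -
    have "a * (p / q) + b = (a * p + b * q) / q" "c * (p / q) + d = (c * p + d * q) / q"
      using q by (simp_all add: field_simps)
    then show ?thesis using q by simp
  qed
  also have "\<dots> = moebius A (moebius B \<tau>)"
    unfolding B\<tau> by (simp add: moebius_def abcd)
  finally show ?thesis .
qed

lemma moebius_one [simp]: "moebius (1\<^sub>m 2) \<tau> = \<tau>"
  by (simp add: moebius_def)

lemma moebius_uminus: "A \<in> carrier_mat 2 2 \<Longrightarrow> moebius (- A) \<tau> = moebius A \<tau>"
proof -
  assume "A \<in> carrier_mat 2 2"
  then have "moebius (- A) \<tau> = - (of_int (A $$ (0,0)) * \<tau> + of_int (A $$ (0,1))) /
      - (of_int (A $$ (1,0)) * \<tau> + of_int (A $$ (1,1)))"
    by (simp add: moebius_def)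
  moreover have "- p / - q = p / q" for p q :: complex by simp
  ultimately show ?thesis by (simp only: moebius_def)
qed

text \<open>The numerator of the imaginary part is the determinant times \<open>Im \<tau>\<close>.
  No condition on \<tau> appears: where the denominator vanishes, both sides are 0 by the convention
  on division.\<close>

lemma Im_moebius:
  assumes "A \<in> carrier SL2Z"
  shows "Im (moebius A \<tau>) = Im \<tau> / (norm (of_int (A $$ (1,0)) * \<tau> + of_int (A $$ (1,1))))\<^sup>2"
proof -
  have "real_of_int (A $$ (0,0) * A $$ (1,1) - A $$ (0,1) * A $$ (1,0)) = 1"
    using assms by (simp only: SL2Z_iff of_int_1)
  then have "Im \<tau> = real_of_int (A $$ (0,0) * A $$ (1,1) - A $$ (0,1) * A $$ (1,0)) * Im \<tau>" by simp
  then show ?thesis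
    unfolding moebius_def Im_divide cmod_power2 by (simp add: algebra_simps)
qed

text \<open>The quotient rule leaves the determinant in the numerator. The result is exactly the
  weight two factor, so composing a primitive of f with \<open>A\<close> gives a primitive of
  \<open>slash2 f A\<close>.\<close>

lemma moebius_has_field_derivative:
  assumes A: "A \<in> carrier SL2Z" and \<tau>: "\<tau> \<in> uhp"
  shows "(moebius A has_field_derivative
    1 / (of_int (A $$ (1,0)) * \<tau> + of_int (A $$ (1,1)))\<^sup>2) (at \<tau>)"
proof -
  define a b c d where abcd: "a = complex_of_int (A $$ (0,0))" "b = complex_of_int (A $$ (0,1))"
    "c = complex_of_int (A $$ (1,0))" "d = complex_of_int (A $$ (1,1))"
  have nz: "c * \<tau> + d \<noteq> 0" using SL2Z_denominator_nonzero[OF A \<tau>] by (simp add: abcd)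
  have "complex_of_int (A $$ (0,0) * A $$ (1,1) - A $$ (0,1) * A $$ (1,0)) = 1"
    using A by (simp only: SL2Z_iff of_int_1)
  then have num: "a * (c * \<tau> + d) - (a * \<tau> + b) * c = 1" by (simp add: abcd algebra_simps)
  have der: "((\<lambda>\<tau>. (a * \<tau> + b) / (c * \<tau> + d)) has_field_derivative
      (a * (c * \<tau> + d) - (a * \<tau> + b) * c) / ((c * \<tau> + d) * (c * \<tau> + d))) (at \<tau>)"
    by (intro DERIV_divide nz) (auto intro!: derivative_eq_intros)
  show ?thesis
    using der[unfolded num] unfolding moebius_def[abs_def] power2_eq_square abcd .
qed

text \<open>A Dirichlet approximation of \<open>Re \<tau>\<close> gives the lower row of the matrix; the constant \<open>1/5\<close> is
  weaker than what the fundamental domain provides but any positive constant will do.\<close>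

lemma SL2Z_translate_Im_ge:
  assumes "\<tau> \<in> uhp"
  obtains A where "A \<in> carrier SL2Z" "Im (moebius A \<tau>) \<ge> 1/5"
proof (cases "Im \<tau> \<ge> 1")
  case True
  then show thesis using that[OF one_SL2Z] by simp
next
  case False
  define y where "y = Im \<tau>"
  have y: "0 < y" "y < 1" using assms False by (auto simp: y_def uhp_def)
  \<comment> \<open>With \<open>N\<close> between 1 / sqrt y and 2 / sqrt y, the approximation makes
    both |k Re \<tau> - h| and k y of order sqrt y, which balances the two parts of the squared
    denominator.\<close>
  define N where "N = nat \<lceil>1 / sqrt y\<rceil>"
  have s: "sqrt y < 1" "sqrt y > 0" "sqrt y * sqrt y = y" using y by auto
  have N1: "1 / sqrt y \<le> N" unfolding N_def by linarith
  have s1: "1 < 1 / sqrt y" using s by simp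
  have "real N < 1 / sqrt y + 1" unfolding N_def using s1 by linarith
  with s1 have N2: "N \<le> 2 / sqrt y" by simp
  have Npos: "0 < N" using N1 s1 by (intro Nat.gr0I) linarith+
  obtain h k where hk: "coprime h k" "0 < k" "k \<le> int N" "\<bar>of_int k * Re \<tau> - of_int h\<bar> < 1 / N"
    using Dirichlet_approx_coprime[OF Npos] by metis
  \<comment> \<open>Bezout coefficients complete the lower row (k, -h) to determinant one.\<close>
  obtain a b where ab: "a * h + b * k = 1"
    using bezout_int[of h k] hk(1) by (metis coprime_imp_gcd_eq_1)
  define A where "A = mat_of_rows_list 2 [[- a, - b], [k, - h]]"
  have Ae: "A $$ (0,0) = - a" "A $$ (0,1) = - b" "A $$ (1,0) = k" "A $$ (1,1) = - h"
    by (simp_all add: A_def mat_of_rows_list_def)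
  have A: "A \<in> carrier SL2Z"
    unfolding SL2Z_iff Ae using ab by (simp add: A_def mat_of_rows_list_def carrier_matI algebra_simps)
  have e1: "(of_int k * Re \<tau> - of_int h)\<^sup>2 \<le> y"
  proof -
    have "1 / N \<le> sqrt y" using N1 Npos s by (simp add: field_simps)
    with hk(4) have "\<bar>of_int k * Re \<tau> - of_int h\<bar> \<le> sqrt y" by linarith
    from power_mono[OF this, of 2] show ?thesis using y by simp
  qed
  have e2: "(of_int k * y)\<^sup>2 \<le> 4 * y"
  proof -
    have "real_of_int k \<le> 2 / sqrt y" using hk(3) N2 by linarith
    then have "of_int k * y \<le> 2 / sqrt y * y" using y by (intro mult_right_mono) auto
    also have "\<dots> = 2 * sqrt y" using s by (simp add: field_simps)
    finally have "(of_int k * y)\<^sup>2 \<le> (2 * sqrt y)\<^sup>2"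
      using hk(2) y by (intro power_mono) auto
    then show ?thesis using y by (simp add: power_mult_distrib)
  qed
  have "(norm (of_int (A $$ (1,0)) * \<tau> + of_int (A $$ (1,1))))\<^sup>2 =
      (of_int k * Re \<tau> - of_int h)\<^sup>2 + (of_int k * y)\<^sup>2"
    unfolding Ae cmod_power2 by (simp add: y_def)
  also have "\<dots> \<le> 5 * y" using e1 e2 by simp
  finally have le: "(norm (of_int (A $$ (1,0)) * \<tau> + of_int (A $$ (1,1))))\<^sup>2 \<le> 5 * y" .
  have "(norm (of_int (A $$ (1,0)) * \<tau> + of_int (A $$ (1,1))))\<^sup>2 > 0"
    using SL2Z_denominator_nonzero[OF A assms] by simp
  with le have "1 / 5 \<le> Im (moebius A \<tau>)"
    unfolding Im_moebius[OF A] y_def by (simp add: divide_simps)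
  with A show thesis by (rule that)
qed

section \<open>Classes modulo sign and coset representatives\<close>

lemma psl_eq_pair: "A \<in> carrier_mat 2 2 \<Longrightarrow> psl A = {A, - A}"
  by (auto simp: psl_def r_coset_def SL2Z_def)

lemma carrier_PSL2Z: "carrier PSL2Z = psl ` carrier SL2Z"
  by (auto simp: PSL2Z_def FactGroup_def RCOSETS_def psl_def)

lemma psl_closed: "A \<in> carrier SL2Z \<Longrightarrow> psl A \<in> carrier PSL2Z"
  by (simp add: carrier_PSL2Z)

lemma psl_mult:
  assumes "A \<in> carrier SL2Z" "B \<in> carrier SL2Z"
  shows "psl A \<otimes>\<^bsub>PSL2Z\<^esub> psl B = psl (A * B)"
  using normal.rcos_sum[OF normal_SL2Z_sign assms]
  by (simp add: psl_def PSL2Z_def FactGroup_def SL2Z_def)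

lemma psl_one: "psl (1\<^sub>m 2) = \<one>\<^bsub>PSL2Z\<^esub>"
  by (auto simp: psl_eq_pair PSL2Z_def FactGroup_def)

lemma moebius_psl_cong:
  assumes "A \<in> carrier SL2Z" "B \<in> carrier SL2Z" "psl A = psl B"
  shows "moebius A \<tau> = moebius B \<tau>"
proof -
  have "A \<in> carrier_mat 2 2" "B \<in> carrier_mat 2 2" using assms(1,2) by (auto simp: SL2Z_iff)
  then have "A = B \<or> A = - B" using assms(3) by (auto simp: psl_eq_pair doubleton_eq_iff)
  with \<open>B \<in> carrier_mat 2 2\<close> show ?thesis by (auto simp: moebius_uminus)
qed

definition mat_T :: "int mat" where
  "mat_T = mat_of_rows_list 2 [[1, 1], [0, 1]]"

lemma mat_T_SL2Z: "mat_T \<in> carrier SL2Z"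
  by (simp add: SL2Z_iff mat_T_def mat_of_rows_list_def carrier_matI)

lemma moebius_mat_T: "moebius mat_T \<tau> = \<tau> + 1"
  by (simp add: moebius_def mat_T_def mat_of_rows_list_def)

text \<open>One matrix is chosen from each coset of \<open>G\<close>. A matrix \<open>A\<close> and
  the representative of its coset differ by left multiplication with some \<open>D\<close> from
  \<open>G\<close>, up to a sign that \<open>moebius\<close> does not see.\<close>

lemma finite_coset_representatives:
  assumes G: "G \<lhd> PSL2Z" and fin: "finite (rcosets\<^bsub>PSL2Z\<^esub> G)"
  obtains R where "finite R" "R \<subseteq> carrier SL2Z"
    "\<And>A. A \<in> carrier SL2Z \<Longrightarrow>
      \<exists>B\<in>R. \<exists>D\<in>carrier SL2Z. psl D \<in> G \<and> (\<forall>\<tau>\<in>uhp. moebius B \<tau> = moebius D (moebius A \<tau>))"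
proof
  interpret normal G PSL2Z by (rule G)
  let ?b = "\<lambda>C. SOME A. A \<in> carrier SL2Z \<and> psl A \<in> C"
  have b: "?b C \<in> carrier SL2Z \<and> psl (?b C) \<in> C" if C: "C \<in> rcosets\<^bsub>PSL2Z\<^esub> G" for C
  proof (rule someI_ex)
    obtain x where x: "x \<in> carrier PSL2Z" "C = G #>\<^bsub>PSL2Z\<^esub> x"
      using C by (auto simp: RCOSETS_def)
    then have "x \<in> C" using rcos_self[OF x(1) subgroup_axioms] by simp
    with x(1) show "\<exists>A. A \<in> carrier SL2Z \<and> psl A \<in> C" by (auto simp: carrier_PSL2Z)
  qed
  show "finite (?b ` (rcosets\<^bsub>PSL2Z\<^esub> G))" using fin by simp
  show "?b ` (rcosets\<^bsub>PSL2Z\<^esub> G) \<subseteq> carrier SL2Z" using b by blast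
  fix A assume A: "A \<in> carrier SL2Z"
  let ?C = "G #>\<^bsub>PSL2Z\<^esub> psl A"
  have C: "?C \<in> rcosets\<^bsub>PSL2Z\<^esub> G"
    using psl_closed[OF A] by (rule rcosetsI[OF subset])
  from b[OF C] obtain h where B: "?b ?C \<in> carrier SL2Z" and h: "h \<in> G" "psl (?b ?C) = h \<otimes>\<^bsub>PSL2Z\<^esub> psl A"
    by (auto simp: r_coset_def)
  obtain D where D: "D \<in> carrier SL2Z" "h = psl D" using h(1) subset by (auto simp: carrier_PSL2Z)
  have "psl (?b ?C) = psl (D * A)" using h(2) psl_mult[OF D(1) A] D(2) by simp
  then have "moebius (?b ?C) \<tau> = moebius D (moebius A \<tau>)" if "\<tau> \<in> uhp" for \<tau>
    using moebius_psl_cong[OF B mult_SL2Z[OF D(1) A]] moebius_mult[OF D(1) A that] by simp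
  with C D h(1) show "\<exists>B\<in>?b ` (rcosets\<^bsub>PSL2Z\<^esub> G). \<exists>D\<in>carrier SL2Z. psl D \<in> G \<and>
      (\<forall>\<tau>\<in>uhp. moebius B \<tau> = moebius D (moebius A \<tau>))"
    by blast
qed

section \<open>Expansions at the cusp\<close>

text \<open>The local parameter q^(1/N) at a cusp of width \<open>N\<close>; \<open>nome 1\<close>
  is the usual q.\<close>

definition nome :: "nat \<Rightarrow> complex \<Rightarrow> complex" where
  "nome N \<tau> = exp (2 * of_real pi * \<i> * \<tau> / of_nat N)"

lemma norm_nome: "norm (nome N \<tau>) = exp (- (2 * pi * Im \<tau> / N))"
  by (simp add: nome_def complex_eq_iff)

lemma nome_nonzero [simp]: "nome N \<tau> \<noteq> 0"
  by (simp add: nome_def)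

lemma nome_in_ball: "0 < N \<Longrightarrow> \<tau> \<in> uhp \<Longrightarrow> nome N \<tau> \<in> ball 0 1"
  by (simp add: norm_nome uhp_def)

text \<open>Identities for \<tau> in the upper half-plane become identities on the punctured disc.
  The preimage is a rescaled logarithm, and |w| < 1 makes its imaginary part positive.\<close>

lemma nome_surj:
  assumes "0 < N" "w \<in> ball 0 1" "w \<noteq> 0"
  obtains \<tau> where "\<tau> \<in> uhp" "nome N \<tau> = w"
proof
  define \<tau> where "\<tau> = Ln w * of_nat N / (2 * of_real pi * \<i>)"
  have "2 * of_real pi * \<i> * \<tau> / of_nat N = Ln w"
    using assms(1) by (simp add: \<tau>_def)
  then show eq: "nome N \<tau> = w"
    using assms(3) by (simp add: nome_def)
  have "exp (- (2 * pi * Im \<tau> / N)) < 1"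
    using assms(2) norm_nome[of N \<tau>] unfolding eq by simp
  then show "\<tau> \<in> uhp"
    using assms(1) by (simp add: uhp_def zero_less_divide_iff zero_less_mult_iff)
qed

lemma nome_add_of_nat: "0 < N \<Longrightarrow> nome N (\<tau> + of_nat N) = nome N \<tau>"
  by (simp add: nome_def distrib_left add_divide_distrib exp_add exp_eq_1 flip: exp_of_nat_mult)

lemma nome_mult_power: "0 < M \<Longrightarrow> nome (N * M) \<tau> ^ M = nome N \<tau>"
  by (simp add: nome_def flip: exp_of_nat_mult)

lemma nome_has_field_derivative [derivative_intros]:
  "(nome N has_field_derivative (2 * of_real pi * \<i> / of_nat N) * nome N \<tau>) (at \<tau> within S)"
proof -
  define c where "c = 2 * of_real pi * \<i> / complex_of_nat N"
  have "nome N = (\<lambda>\<tau>. exp (c * \<tau>))"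
    by (simp add: nome_def c_def fun_eq_iff)
  then show ?thesis
    unfolding c_def[symmetric] by (auto intro!: derivative_eq_intros)
qed

lemma tendsto_nome_imaginary:
  assumes "0 < N"
  shows "((\<lambda>Y::real. nome N (\<i> * of_real Y)) \<longlongrightarrow> 0) at_top"
proof (rule tendsto_norm_zero_cancel)
  have "((\<lambda>Y. exp (- (2 * pi * Y / real N))) \<longlongrightarrow> 0) at_top"
    using assms by real_asymp
  then show "((\<lambda>Y. norm (nome N (\<i> * of_real Y))) \<longlongrightarrow> 0) at_top"
    by (simp add: norm_nome)
qed

lemma open_uhp: "open uhp"
  unfolding uhp_def by (rule open_halfspace_Im_gt)

lemma convex_uhp: "convex uhp"
  unfolding uhp_def by (rule convex_halfspace_Im_gt)

lemma uhp_nonempty: "\<i> \<in> uhp"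
  by (simp add: uhp_def)

lemma DERIV_zero_uhp_const:
  assumes "\<And>\<tau>. \<tau> \<in> uhp \<Longrightarrow> (v has_field_derivative 0) (at \<tau>)" "\<tau> \<in> uhp" "\<tau>' \<in> uhp"
  shows "v \<tau> = v \<tau>'"
proof -
  obtain c where "\<And>\<tau>. \<tau> \<in> uhp \<Longrightarrow> v \<tau> = c"
    using DERIV_zero_connected_constant[of uhp "{}" v] assms(1) open_uhp
      convex_connected[OF convex_uhp]
    by (metis (no_types, lifting) DERIV_isCont Diff_empty continuous_at_imp_continuous_on finite.emptyI)
  with assms(2,3) show ?thesis by simp
qed

text \<open>In the coordinate w = q^(1/N), f d\<tau> equals N / (2 pi i) times h(w)/w dw. As h
  vanishes at 0, the quotient h(w)/w is holomorphic on the disc and has a primitive there.\<close>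

lemma integral_from_cusp_expansion:
  assumes N: "0 < N" and holh: "h holomorphic_on ball 0 1" and h0: "h 0 = 0"
    and fh: "\<And>\<tau>. \<tau> \<in> uhp \<Longrightarrow> f \<tau> = h (nome N \<tau>)"
  obtains H where "H holomorphic_on ball 0 1" "H 0 = 0"
    "\<And>\<tau>. \<tau> \<in> uhp \<Longrightarrow> integral_from_cusp f \<tau> = H (nome N \<tau>)"
    "\<And>\<tau>. \<tau> \<in> uhp \<Longrightarrow> (integral_from_cusp f has_field_derivative f \<tau>) (at \<tau>)"
proof -
  obtain k where holk: "k holomorphic_on ball 0 1" and hk: "\<And>z. norm z < 1 \<Longrightarrow> h z = z * k z"
    using Schwarz3[OF holh h0] by metis
  obtain K where K: "\<And>w. w \<in> ball 0 1 \<Longrightarrow> (K has_field_derivative k w) (at w within ball 0 1)"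
    using holomorphic_convex_primitive'[OF convex_ball open_ball holk] by blast
  \<comment> \<open>The constant cancels the factor in the derivative of \<open>nome N\<close>.
    Subtracting \<open>K 0\<close> makes the contribution of the lower endpoint i Y tend to
    0.\<close>
  define H where "H w = of_nat N / (2 * of_real pi * \<i>) * (K w - K 0)" for w
  have H': "(H has_field_derivative of_nat N / (2 * of_real pi * \<i>) * k w) (at w)"
    if "w \<in> ball 0 1" for w
    using K[OF that] that unfolding H_def
    by (auto intro!: derivative_eq_intros simp: at_within_open[OF _ open_ball])
  have holH: "H holomorphic_on ball 0 1"
    using H' unfolding holomorphic_on_open[OF open_ball] by blast
  have H0: "H 0 = 0" by (simp add: H_def)
  have prim: "((\<lambda>\<tau>. H (nome N \<tau>)) has_field_derivative f \<tau>) (at \<tau>)" if "\<tau> \<in> uhp" for \<tau>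
  proof -
    have b: "nome N \<tau> \<in> ball 0 1" using nome_in_ball[OF N that] .
    have "((\<lambda>\<tau>. H (nome N \<tau>)) has_field_derivative
        (of_nat N / (2 * of_real pi * \<i>) * k (nome N \<tau>)) *
        ((2 * of_real pi * \<i> / of_nat N) * nome N \<tau>)) (at \<tau>)"
      by (rule DERIV_chain2[OF H'[OF b] nome_has_field_derivative])
    also have "(of_nat N / (2 * of_real pi * \<i>) * k (nome N \<tau>)) *
        ((2 * of_real pi * \<i> / of_nat N) * nome N \<tau>) = f \<tau>"
    proof -
      have "of_nat N / (2 * of_real pi * \<i>) * (2 * of_real pi * \<i> / of_nat N) = 1" using N by simp
      then have "(of_nat N / (2 * of_real pi * \<i>) * k (nome N \<tau>)) *
          ((2 * of_real pi * \<i> / of_nat N) * nome N \<tau>) = nome N \<tau> * k (nome N \<tau>)"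
        by (metis mult.assoc mult.commute mult.left_commute mult_1)
      then show ?thesis using b by (simp add: fh[OF that] hk)
    qed
    finally show ?thesis .
  qed
  have int: "integral_from_cusp f \<tau> = H (nome N \<tau>)" if \<tau>: "\<tau> \<in> uhp" for \<tau>
  proof -
    have ev: "eventually (\<lambda>Y::real. H (nome N \<tau>) - H (nome N (\<i> * of_real Y)) =
        contour_integral (linepath (\<i> * of_real Y) \<tau>) f) at_top"
      using eventually_gt_at_top[of 0]
    proof eventually_elim
      case (elim Y)
      have "closed_segment (\<i> * of_real Y) \<tau> \<subseteq> uhp"
        using elim \<tau> by (intro closed_segment_subset convex_uhp) (auto simp: uhp_def)
      then have "(f has_contour_integral H (nome N \<tau>) - H (nome N (\<i> * of_real Y)))
          (linepath (\<i> * of_real Y) \<tau>)"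
        using contour_integral_primitive[of uhp "\<lambda>\<tau>. H (nome N \<tau>)" f "linepath (\<i> * of_real Y) \<tau>"]
          has_field_derivative_at_within[OF prim]
        by simp
      then show ?case by (simp add: contour_integral_unique)
    qed
    have "isCont H 0"
      using H'[of 0] DERIV_isCont by auto
    from isCont_tendsto_compose[OF this tendsto_nome_imaginary[OF N]]
    have "((\<lambda>Y::real. H (nome N \<tau>) - H (nome N (\<i> * of_real Y))) \<longlongrightarrow> H (nome N \<tau>) - 0) at_top"
      by (intro tendsto_intros) (simp add: H0)
    from Lim_transform_eventually[OF this ev] show ?thesis
      unfolding integral_from_cusp_def by (intro tendsto_Lim) auto
  qed
  show thesis
  proof (rule that[OF holH H0 int])
    fix \<tau> assume \<tau>: "\<tau> \<in> uhp"
    show "(integral_from_cusp f has_field_derivative f \<tau>) (at \<tau>)"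
      by (rule has_field_derivative_transform_within_open[OF prim[OF \<tau>] open_uhp \<tau>])
        (simp add: int)
  qed
qed

text \<open>The equivariance says that \<open>H (\<zeta> w) = \<zeta>\<^sup>s H w\<close> for a primitive \<open>N\<close>-th root of unity \<open>\<zeta>\<close>, so the
  Taylor coefficients of \<open>H\<close> vanish at all exponents not congruent to \<open>s\<close> modulo \<open>N\<close>.\<close>

lemma equivariant_power_series_factor:
  fixes H :: "complex \<Rightarrow> complex"
  assumes N: "0 < N" and s: "s < N" and holH: "H holomorphic_on ball 0 1"
    and equiv: "\<And>\<tau>. \<tau> \<in> uhp \<Longrightarrow> H (nome N (\<tau> + 1)) = nome N (of_nat s) * H (nome N \<tau>)"
  obtains K where "K holomorphic_on ball 0 1"
    "\<And>\<tau>. \<tau> \<in> uhp \<Longrightarrow> H (nome N \<tau>) = nome N (of_nat s * \<tau>) * K (nome 1 \<tau>)"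
proof -
  define \<zeta> where "\<zeta> = nome N 1"
  define a where "a n = (deriv ^^ n) H 0 / fact n" for n
  have \<zeta>1: "norm \<zeta> = 1" by (simp add: \<zeta>_def norm_nome)
  have \<zeta>s: "nome N (of_nat n) = \<zeta> ^ n" for n
    by (simp add: \<zeta>_def nome_def mult_ac flip: exp_of_nat_mult)
  have sums: "(\<lambda>n. a n * w ^ n) sums H w" if "w \<in> ball 0 1" for w
    using holomorphic_power_series[OF holH that] by (simp add: a_def)
  have hol\<zeta>: "(\<lambda>w. H (\<zeta> * w)) holomorphic_on ball 0 1"
    by (rule holomorphic_on_compose_gen[OF _ holH, unfolded o_def])
      (use \<zeta>1 in \<open>auto intro!: holomorphic_intros simp: norm_mult\<close>)
  have eq': "H (\<zeta> * w) = \<zeta> ^ s * H w" if w: "w \<in> ball 0 1 - {0}" for w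
  proof -
    obtain \<tau> where \<tau>: "\<tau> \<in> uhp" "nome N \<tau> = w" using nome_surj[OF N, of w] w by blast
    have "nome N (\<tau> + 1) = \<zeta> * w"
      by (simp add: \<tau>(2)[symmetric] \<zeta>_def nome_def distrib_left add_divide_distrib exp_add mult_ac)
    with equiv[OF \<tau>(1)] show ?thesis by (simp add: \<zeta>s \<tau>)
  qed
  \<comment> \<open>The point 0 is not a value of \<open>nome\<close>, so the relation is extended
    there by continuity.\<close>
  have eq: "H (\<zeta> * w) = \<zeta> ^ s * H w" if w: "w \<in> ball 0 1" for w
  proof (cases "w = 0")
    case True
    let ?E = "\<lambda>w. H (\<zeta> * w) - \<zeta> ^ s * H w"
    have "?E holomorphic_on ball 0 1"
      using hol\<zeta> holH by (intro holomorphic_intros)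
    then have "isCont ?E 0"
      by (intro holomorphic_on_imp_continuous_on[THEN continuous_on_interior[where x = 0]]) auto
    then have "?E \<midarrow>0\<rightarrow> ?E 0" by (simp add: isCont_def)
    moreover have "eventually (\<lambda>w. ?E w = 0) (at 0)"
      unfolding eventually_at by (intro exI[of _ 1]) (use eq' in auto)
    then have "?E \<midarrow>0\<rightarrow> 0" by (rule tendsto_eventually)
    ultimately have "?E 0 = 0" by (rule LIM_unique)
    with True show ?thesis by simp
  qed (use eq' w in auto)
  have a0: "a n = 0" if n: "n mod N \<noteq> s" for n
  proof -
    have ne: "\<zeta> ^ n \<noteq> \<zeta> ^ s"
    proof
      assume "\<zeta> ^ n = \<zeta> ^ s"
      moreover have "\<zeta> = exp (2 * of_real pi * \<i> / of_nat N)" by (simp add: \<zeta>_def nome_def)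
      moreover have "\<zeta> ^ n = exp (2 * of_real pi * \<i> * of_nat n / of_nat N)"
        "\<zeta> ^ s = exp (2 * of_real pi * \<i> * of_nat s / of_nat N)"
        unfolding \<zeta>s[symmetric] by (simp_all add: nome_def)
      ultimately have "n mod N = s mod N"
        using N complex_root_unity_eq[of N n s] by simp
      with n s show False by simp
    qed
    have "\<zeta> ^ n * (deriv ^^ n) H 0 = (deriv ^^ n) (\<lambda>w. H (\<zeta> * w)) 0"
      using higher_deriv_compose_linear[OF holH open_ball open_ball, of 0 0 1 \<zeta> n] \<zeta>1
      by (simp add: norm_mult)
    also have "\<dots> = (deriv ^^ n) (\<lambda>w. \<zeta> ^ s * H w) 0"
      by (rule higher_deriv_transform_within_open[OF hol\<zeta> _ open_ball])
        (use holH eq in \<open>auto intro!: holomorphic_intros\<close>)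
    also have "\<dots> = \<zeta> ^ s * (deriv ^^ n) H 0"
      by (rule higher_deriv_cmult[OF holH]) auto
    finally show ?thesis using ne by (simp add: a_def)
  qed
  define b where "b n = a (s + N * n)" for n
  define K where "K q = suminf (\<lambda>n. b n * q ^ n)" for q
  have nome_s: "nome N (of_nat s * \<tau>) = nome N \<tau> ^ s" for \<tau>
    by (simp add: nome_def mult_ac flip: exp_of_nat_mult)
  have nome_1: "nome 1 \<tau> = nome N \<tau> ^ N" for \<tau>
    using nome_mult_power[OF N, of 1 \<tau>] by simp
  have bs: "(\<lambda>n. b n * nome 1 \<tau> ^ n) sums (H (nome N \<tau>) / nome N \<tau> ^ s)" if \<tau>: "\<tau> \<in> uhp" for \<tau>
  proof -
    have "strict_mono (\<lambda>n. s + N * n)" using N by (simp add: strict_mono_def)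
    moreover have "a m * nome N \<tau> ^ m = 0" if "m \<notin> range (\<lambda>n. s + N * n)" for m
    proof -
      have "m mod N \<noteq> s"
      proof
        assume "m mod N = s"
        then have "m = s + N * (m div N)" by (metis mod_mult_div_eq)
        with that show False by blast
      qed
      with a0 show ?thesis by simp
    qed
    ultimately have "(\<lambda>n. a (s + N * n) * nome N \<tau> ^ (s + N * n)) sums H (nome N \<tau>)"
      using sums_mono_reindex[of "\<lambda>n. s + N * n" "\<lambda>m. a m * nome N \<tau> ^ m"]
        sums[OF nome_in_ball[OF N \<tau>]] by blast
    from sums_divide[OF this, of "nome N \<tau> ^ s"] show ?thesis
      by (simp add: b_def power_add power_mult flip: nome_1)
  qed
  have "K holomorphic_on ball 0 1"
  proof (rule power_series_holomorphic[of _ _ b])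
    fix q :: complex assume q: "q \<in> ball 0 1"
    \<comment> \<open>Every nonzero q in the disc is some \<open>nome 1 \<tau>\<close>, so
      convergence can be read off from \<open>bs\<close>.\<close>
    have "summable (\<lambda>n. b n * q ^ n)"
    proof (cases "q = 0")
      case False
      then obtain \<tau> where "\<tau> \<in> uhp" "nome 1 \<tau> = q" using nome_surj[of 1 q] q by auto
      with bs show ?thesis by (auto simp: sums_iff)
    qed auto
    then show "(\<lambda>n. b n * (q - 0) ^ n) sums K q" by (simp add: K_def summable_sums)
  qed
  moreover have "H (nome N \<tau>) = nome N (of_nat s * \<tau>) * K (nome 1 \<tau>)" if "\<tau> \<in> uhp" for \<tau>
    using bs[OF that] by (simp add: K_def nome_s sums_iff)
  ultimately show thesis by (rule that)
qed

section \<open>Expansions of the cusp forms and of their integrals\<close>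

lemma cusp_form2_expansion:
  assumes "cusp_form2 G f"
  obtains N h where "0 < N" "h holomorphic_on ball 0 1" "h 0 = 0"
    "\<And>\<tau>. \<tau> \<in> uhp \<Longrightarrow> f \<tau> = h (nome N \<tau>)"
proof -
  have "slash2 f (1\<^sub>m 2) \<tau> = f \<tau>" for \<tau> by (simp add: slash2_def moebius_def)
  then show thesis
    using assms one_SL2Z that unfolding cusp_form2_def nome_def by metis
qed

text \<open>Each form comes with its own width. The product of the widths serves all of them at
  once, since the parameter for a divisor of \<open>N\<close> is a power of
  \<open>nome N\<close>.\<close>

lemma common_period_expansion:
  fixes g :: nat
  assumes "\<And>k. k < g \<Longrightarrow> cusp_form2 G (f k)"
  obtains N H where "0 < N" "\<And>k. k < g \<Longrightarrow> H k holomorphic_on ball 0 1"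
    "\<And>k \<tau>. k < g \<Longrightarrow> \<tau> \<in> uhp \<Longrightarrow> integral_from_cusp (f k) \<tau> = H k (nome N \<tau>)"
    "\<And>k \<tau>. k < g \<Longrightarrow> \<tau> \<in> uhp \<Longrightarrow> (integral_from_cusp (f k) has_field_derivative f k \<tau>) (at \<tau>)"
proof -
  have "\<forall>k. \<exists>N H. k < g \<longrightarrow> 0 < N \<and> H holomorphic_on ball 0 1 \<and>
      (\<forall>\<tau>\<in>uhp. integral_from_cusp (f k) \<tau> = H (nome N \<tau>) \<and>
        (integral_from_cusp (f k) has_field_derivative f k \<tau>) (at \<tau>))"
  proof (intro allI)
    fix k
    show "\<exists>N H. k < g \<longrightarrow> 0 < N \<and> H holomorphic_on ball 0 1 \<and>
      (\<forall>\<tau>\<in>uhp. integral_from_cusp (f k) \<tau> = H (nome N \<tau>) \<and>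
        (integral_from_cusp (f k) has_field_derivative f k \<tau>) (at \<tau>))"
    proof (cases "k < g")
      case True
      obtain N h where h: "0 < N" "h holomorphic_on ball 0 1" "h 0 = 0"
        "\<And>\<tau>. \<tau> \<in> uhp \<Longrightarrow> f k \<tau> = h (nome N \<tau>)"
        using cusp_form2_expansion[OF assms[OF True]] by metis
      obtain H where "H holomorphic_on ball 0 1"
        "\<And>\<tau>. \<tau> \<in> uhp \<Longrightarrow> integral_from_cusp (f k) \<tau> = H (nome N \<tau>)"
        "\<And>\<tau>. \<tau> \<in> uhp \<Longrightarrow> (integral_from_cusp (f k) has_field_derivative f k \<tau>) (at \<tau>)"
        using integral_from_cusp_expansion[OF h] by metis
      with h(1) show ?thesis by blast
    qed auto
  qed
  then obtain N0 H0 where NH: "\<And>k. k < g \<Longrightarrow> 0 < N0 k \<and> H0 k holomorphic_on ball 0 1 \<and>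
      (\<forall>\<tau>\<in>uhp. integral_from_cusp (f k) \<tau> = H0 k (nome (N0 k) \<tau>) \<and>
        (integral_from_cusp (f k) has_field_derivative f k \<tau>) (at \<tau>))"
    by metis
  define N where "N = (\<Prod>k<g. N0 k)"
  define m where "m k = N div N0 k" for k
  have N: "0 < N" unfolding N_def using NH by (intro prod_pos) auto
  have m: "N = N0 k * m k" "0 < m k" if "k < g" for k
  proof -
    have "N0 k dvd N" unfolding N_def by (rule dvd_prodI) (use that in auto)
    then show "N = N0 k * m k" by (simp add: m_def)
    with N show "0 < m k" by (cases "m k") auto
  qed
  show thesis
  proof (rule that[of N "\<lambda>k w. H0 k (w ^ m k)"])
    fix k assume k: "k < g"
    show "(\<lambda>w. H0 k (w ^ m k)) holomorphic_on ball 0 1"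
    proof (rule holomorphic_on_compose_gen[of "\<lambda>w. w ^ m k" _ "H0 k" "ball 0 1", unfolded o_def])
      show "(\<lambda>w. w ^ m k) ` ball 0 1 \<subseteq> ball (0::complex) 1"
        using m(2)[OF k] by (auto simp: norm_power power_less_one_iff)
    qed (use NH[OF k] in \<open>auto intro!: holomorphic_intros\<close>)
    fix \<tau> assume \<tau>: "\<tau> \<in> uhp"
    show "integral_from_cusp (f k) \<tau> = H0 k (nome N \<tau> ^ m k)"
      using NH[OF k] \<tau> nome_mult_power[OF m(2)[OF k], of "N0 k"] m(1)[OF k] by simp
    show "(integral_from_cusp (f k) has_field_derivative f k \<tau>) (at \<tau>)"
      using NH[OF k] \<tau> by blast
  qed (rule N)
qed

text \<open>By \<open>SL2Z_translate_Im_ge\<close> the values of \<open>v\<close> are those of the finitely many \<open>K B\<close> on one compact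
  disc inside the unit disc, so some \<open>K B\<close> attains its maximum in the interior.\<close>

lemma finite_translates_imp_constant:
  assumes N: "0 < N" and fin: "finite R" and R: "R \<subseteq> carrier SL2Z"
    and holK: "\<And>B. B \<in> R \<Longrightarrow> K B holomorphic_on ball 0 1"
    and vK: "\<And>B \<tau>. B \<in> R \<Longrightarrow> \<tau> \<in> uhp \<Longrightarrow> v (moebius B \<tau>) = K B (nome N \<tau>)"
    and cover: "\<And>A. A \<in> carrier SL2Z \<Longrightarrow> \<exists>B\<in>R. \<forall>\<tau>\<in>uhp. v (moebius A \<tau>) = v (moebius B \<tau>)"
  obtains c where "\<And>\<tau>. \<tau> \<in> uhp \<Longrightarrow> v \<tau> = c"
proof -
  \<comment> \<open>The absolute value of \<open>nome N\<close> at height 1/5, the height reached by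
    \<open>SL2Z_translate_Im_ge\<close>; greater heights give smaller values.\<close>
  define r where "r = exp (- (2 * pi * (1/5) / N))"
  have r: "0 \<le> r" "r < 1" using N by (auto simp: r_def)
  define X where "X = (\<Union>B\<in>R. (\<lambda>w. norm (K B w)) ` cball 0 r)"
  have sub: "cball 0 r \<subseteq> ball (0::complex) 1" using r by auto
  have "compact X"
    unfolding X_def using fin holK
    by (intro compact_UN compact_continuous_image continuous_intros
        holomorphic_on_imp_continuous_on holomorphic_on_subset[OF _ sub]) auto
  moreover have "R \<noteq> {}" using cover[OF one_SL2Z] by auto
  then have "X \<noteq> {}" using r by (auto simp: X_def)
  ultimately obtain M where "M \<in> X" and M: "\<And>x. x \<in> X \<Longrightarrow> x \<le> M"
    using compact_attains_sup by metis
  then obtain B0 w0 where B0: "B0 \<in> R" and w0: "w0 \<in> cball 0 r" and Meq: "M = norm (K B0 w0)"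
    by (auto simp: X_def)
  have bound: "norm (K B0 w) \<le> norm (K B0 w0)" if w: "w \<in> ball 0 1" for w
  proof (cases "w = 0")
    \<comment> \<open>The centre is not of the form \<open>nome N \<tau>\<close>, but it belongs to
      the compact disc.\<close>
    case True
    then have "norm (K B0 w) \<in> X"
      using B0 r unfolding X_def by (intro UN_I[OF B0] imageI) simp
    then show ?thesis using M unfolding Meq by blast
  next
    case False
    then obtain \<tau> where \<tau>: "\<tau> \<in> uhp" "nome N \<tau> = w" using nome_surj[OF N w] by metis
    have B0\<tau>: "moebius B0 \<tau> \<in> uhp" using B0 R \<tau> moebius_uhp by blast
    \<comment> \<open>Once the point is moved up to \<sigma> by \<open>A\<close>, undoing the move
      by \<open>A'\<close> expresses the value of \<open>v\<close> through some \<open>K B\<close>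
      at \<open>nome N \<sigma>\<close>, which lies in the compact disc.\<close>
    obtain A where A: "A \<in> carrier SL2Z" "Im (moebius A (moebius B0 \<tau>)) \<ge> 1/5"
      using SL2Z_translate_Im_ge[OF B0\<tau>] .
    obtain A' where A': "A' \<in> carrier SL2Z" "A' * A = 1\<^sub>m 2" using SL2Z_inverse[OF A(1)] by metis
    define \<sigma> where "\<sigma> = moebius A (moebius B0 \<tau>)"
    have \<sigma>: "\<sigma> \<in> uhp" unfolding \<sigma>_def using A B0\<tau> moebius_uhp by blast
    obtain B where B: "B \<in> R" "v (moebius A' \<sigma>) = v (moebius B \<sigma>)"
      using cover[OF A'(1)] \<sigma> by blast
    have "moebius A' \<sigma> = moebius B0 \<tau>"
      using moebius_mult[OF A'(1) A(1) B0\<tau>] A'(2) by (simp add: \<sigma>_def)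
    with B vK[OF B0 \<tau>(1)] vK[OF B(1) \<sigma>] have "K B0 w = K B (nome N \<sigma>)" by (simp add: \<tau>)
    moreover have "nome N \<sigma> \<in> cball 0 r"
      using A(2) N unfolding \<sigma>_def[symmetric]
      by (simp add: norm_nome r_def field_simps)
    ultimately have "norm (K B0 w) \<in> X" using B(1) unfolding X_def by (intro UN_I[OF B(1)]) simp
    then show ?thesis using M unfolding Meq by blast
  qed
  have "K B0 constant_on ball 0 1"
    by (rule maximum_modulus_principle[where U = "ball 0 1" and \<xi> = w0])
      (use holK[OF B0] sub w0 bound in auto)
  then obtain c where c: "\<And>w. w \<in> ball 0 1 \<Longrightarrow> K B0 w = c" by (auto simp: constant_on_def)
  have B0c: "B0 \<in> carrier SL2Z" using B0 R by blast
  \<comment> \<open>Every point of the upper half-plane is the image under \<open>B0\<close> of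
    another one, so the constancy of \<open>K B0\<close> passes to \<open>v\<close>.\<close>
  obtain B' where B': "B' \<in> carrier SL2Z" "B0 * B' = 1\<^sub>m 2" using SL2Z_inverse[OF B0c] by metis
  have "v \<tau> = c" if \<tau>: "\<tau> \<in> uhp" for \<tau>
  proof -
    have u: "moebius B' \<tau> \<in> uhp" using moebius_uhp[OF B'(1) \<tau>] .
    have "\<tau> = moebius B0 (moebius B' \<tau>)"
      using moebius_mult[OF B0c B'(1) \<tau>] B'(2) by simp
    then have "v \<tau> = K B0 (nome N (moebius B' \<tau>))" using vK[OF B0 u] by simp
    with c nome_in_ball[OF N u] show ?thesis by simp
  qed
  then show thesis by (rule that)
qed

section \<open>Matrices of finite order\<close>

lemma four_block_diag_eq_one:
  assumes A: "A \<in> carrier_mat n n" and B: "B \<in> carrier_mat m m"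
    and eq: "four_block_mat A (0\<^sub>m n m) (0\<^sub>m m n) B = 1\<^sub>m (n + m)"
  shows "A = 1\<^sub>m n" "B = 1\<^sub>m m"
proof -
  show "A = 1\<^sub>m n"
  proof (rule eq_matI)
    fix i j assume ij: "i < dim_row (1\<^sub>m n :: 'a mat)" "j < dim_col (1\<^sub>m n :: 'a mat)"
    have "four_block_mat A (0\<^sub>m n m) (0\<^sub>m m n) B $$ (i,j) = 1\<^sub>m (n + m) $$ (i,j)" by (simp only: eq)
    then show "A $$ (i,j) = 1\<^sub>m n $$ (i,j)" using ij A B by simp
  qed (use A in auto)
  show "B = 1\<^sub>m m"
  proof (rule eq_matI)
    fix i j assume ij: "i < dim_row (1\<^sub>m m :: 'a mat)" "j < dim_col (1\<^sub>m m :: 'a mat)"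
    have "four_block_mat A (0\<^sub>m n m) (0\<^sub>m m n) B $$ (n + i, n + j) = 1\<^sub>m (n + m) $$ (n + i, n + j)"
      by (simp only: eq)
    then show "B $$ (i,j) = 1\<^sub>m m $$ (i,j)" using ij A B by simp
  qed (use B in auto)
qed

text \<open>A block of size at least two has N a^(N-1) as the entry (0,1) of its N-th power, which
  is nonzero in characteristic zero.\<close>

lemma jordan_block_power_eq_one:
  fixes a :: "'a :: field_char_0"
  assumes N: "0 < N" and k: "k \<noteq> 0" and eq: "jordan_block k a ^\<^sub>m N = 1\<^sub>m k"
  shows "k = 1" "a ^ N = 1"
proof -
  have "(jordan_block k a ^\<^sub>m N) $$ (0,0) = 1" using k by (simp add: eq)
  then show aN: "a ^ N = 1" using k by (simp add: jordan_block_pow)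
  show "k = 1"
  proof (rule ccontr)
    assume "k \<noteq> 1"
    with k have k1: "1 < k" by simp
    then have "(jordan_block k a ^\<^sub>m N) $$ (0,1) = 0" by (simp add: eq)
    then have "of_nat N * a ^ (N - 1) = 0" using k1 by (simp add: jordan_block_pow)
    with N have "a ^ (N - 1) = 0" by simp
    with N aN show False by (auto simp: power_0_left)
  qed
qed

text \<open>Powers are taken block by block, so the previous lemma shrinks every block to size one.
  Empty blocks are excluded, so that the number of blocks equals the dimension.\<close>

lemma jordan_matrix_power_eq_one:
  fixes n_as :: "(nat \<times> 'a :: field_char_0) list"
  assumes N: "0 < N" and n0: "0 \<notin> fst ` set n_as"
    and eq: "jordan_matrix n_as ^\<^sub>m N = 1\<^sub>m (sum_list (map fst n_as))"
  shows "sum_list (map fst n_as) = length n_as"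
    "jordan_matrix n_as = mat_diag (length n_as) (\<lambda>i. snd (n_as ! i))"
    "\<forall>i < length n_as. snd (n_as ! i) ^ N = 1"
proof -
  have "sum_list (map fst n_as) = length n_as \<and>
    jordan_matrix n_as = mat_diag (length n_as) (\<lambda>i. snd (n_as ! i)) \<and>
    (\<forall>i < length n_as. snd (n_as ! i) ^ N = 1)"
    using n0 eq
  proof (induction n_as)
    case Nil
    show ?case by (simp add: jordan_matrix_def mat_diag_def) (auto intro!: eq_matI)
  next
    case (Cons na n_as)
    obtain k a where na: "na = (k, a)" by force
    define m where "m = sum_list (map fst n_as)"
    have J: "jordan_matrix n_as \<in> carrier_mat m m" by (simp add: m_def)
    have "four_block_mat (jordan_block k a) (0\<^sub>m k m) (0\<^sub>m m k) (jordan_matrix n_as) ^\<^sub>m N =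
        four_block_mat (jordan_block k a ^\<^sub>m N) (0\<^sub>m k m) (0\<^sub>m m k) (jordan_matrix n_as ^\<^sub>m N)"
      by (rule pow_four_block_mat[OF _ J]) simp
    with Cons.prems(2) have
      "four_block_mat (jordan_block k a ^\<^sub>m N) (0\<^sub>m k m) (0\<^sub>m m k) (jordan_matrix n_as ^\<^sub>m N) = 1\<^sub>m (k + m)"
      by (simp add: na jordan_matrix_Cons m_def)
    from four_block_diag_eq_one[OF _ _ this]
    have 1: "jordan_block k a ^\<^sub>m N = 1\<^sub>m k" and 2: "jordan_matrix n_as ^\<^sub>m N = 1\<^sub>m m"
      using J by auto
    have "k \<noteq> 0" using Cons.prems(1) by (force simp: na)
    note k = jordan_block_power_eq_one[OF N this 1]
    have IH: "m = length n_as" "jordan_matrix n_as = mat_diag m (\<lambda>i. snd (n_as ! i))"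
      "\<forall>i < m. snd (n_as ! i) ^ N = 1"
      using Cons.IH Cons.prems(1) 2 by (auto simp: m_def)
    have "jordan_matrix (na # n_as) = mat_diag (length (na # n_as)) (\<lambda>i. snd ((na # n_as) ! i))"
      unfolding na jordan_matrix_Cons m_def[symmetric] IH(2)
      by (rule eq_matI) (auto simp: k IH(1) mat_diag_def nth_Cons' jordan_block_def)
    with IH k show ?case by (auto simp: na m_def[symmetric] nth_Cons' less_Suc_eq_0_disj)
  qed
  then show "sum_list (map fst n_as) = length n_as"
    "jordan_matrix n_as = mat_diag (length n_as) (\<lambda>i. snd (n_as ! i))"
    "\<forall>i < length n_as. snd (n_as ! i) ^ N = 1" by auto
qed

text \<open>The Jordan form exists over the complex numbers and inherits the relation
  \<open>R ^\<^sub>m N = 1\<^sub>m n\<close> by conjugation, so it is diagonal.\<close>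

lemma finite_order_mat_diagonalization:
  fixes R :: "complex mat"
  assumes R: "R \<in> carrier_mat n n" and N: "0 < N" and eq: "R ^\<^sub>m N = 1\<^sub>m n"
  obtains P Q d where "similar_mat_wit R (mat_diag n d) P Q" "\<And>i. i < n \<Longrightarrow> d i ^ N = 1"
proof -
  obtain as where "char_poly R = (\<Prod>a\<leftarrow>as. [:- a, 1:])"
    using char_poly_factorized[OF R] by blast
  then obtain n_as where "jordan_nf R n_as"
    using jordan_nf_exists[OF R] by blast
  then have n0: "0 \<notin> fst ` set n_as" and "similar_mat R (jordan_matrix n_as)"
    by (auto simp: jordan_nf_def)
  then obtain P Q where wit: "similar_mat_wit R (jordan_matrix n_as) P Q"
    by (auto simp: similar_mat_def)
  note D = similar_mat_witD2[OF R wit]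
  have n: "n = sum_list (map fst n_as)" using D(5) by (metis carrier_matD(1) jordan_matrix_dim(1))
  have "jordan_matrix n_as ^\<^sub>m N = Q * 1\<^sub>m n * P"
    using similar_mat_wit_pow_id[OF similar_mat_wit_sym[OF wit], of N] eq by simp
  then have "jordan_matrix n_as ^\<^sub>m N = 1\<^sub>m n" using D(1,2,6,7) by simp
  note J = jordan_matrix_power_eq_one[OF N n0 this[unfolded n]]
  show thesis
    by (rule that[of "\<lambda>i. snd (n_as ! i)" P Q]) (use wit J n in auto)
qed

section \<open>Exponentials of diagonalizable matrices\<close>

lemma conj_mat_diag_index:
  assumes "P \<in> carrier_mat n n" "Q \<in> carrier_mat n n" "i < n" "j < n"
  shows "(P * mat_diag n f * Q) $$ (i,j) = (\<Sum>l<n. P $$ (i,l) * f l * Q $$ (l,j))"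
  using assms by (simp add: mat_diag_mult_right[OF assms(1)] scalar_prod_def atLeast0LessThan)

lemma mat_diag_power: "mat_diag n f ^\<^sub>m k = mat_diag n (\<lambda>i. f i ^ k :: 'a :: comm_semiring_1)"
proof (induction k)
  case 0
  then show ?case using mat_diag_one by (simp add: mat_diag_def)
next
  case (Suc k)
  then show ?case by (simp add: mult.commute)
qed

lemma mat_diag_smult: "c \<cdot>\<^sub>m mat_diag n f = mat_diag n (\<lambda>i. c * f i :: 'a :: semiring_0)"
  by (rule eq_matI) (auto simp: mat_diag_def)

lemma similar_mat_wit_diag_carrier:
  assumes "similar_mat_wit L (mat_diag n f) P Q"
  shows "L \<in> carrier_mat n n"
proof -
  have "dim_row L = n"
    using carrier_matD(1)[OF similar_mat_witD(5)[OF refl assms]] carrier_matD(1)[OF mat_diag_dim]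
    by metis
  with similar_mat_witD(4)[OF refl assms] show ?thesis by simp
qed

text \<open>Conjugation commutes with powers, so each entry of the exponential series is a finite
  combination of scalar exponential series.\<close>

lemma mat_exp_similar_diag:
  assumes wit: "similar_mat_wit L (mat_diag n f) P Q"
  shows "mat_exp (c \<cdot>\<^sub>m L) = P * mat_diag n (\<lambda>i. exp (c * f i)) * Q"
proof -
  note D = similar_mat_witD2[OF similar_mat_wit_diag_carrier[OF wit] wit]
  have pow: "(c \<cdot>\<^sub>m L) ^\<^sub>m k = P * mat_diag n (\<lambda>i. (c * f i) ^ k) * Q" for k
    using similar_mat_wit_pow_id[OF similar_mat_wit_smult[OF wit, of c], of k]
    by (simp add: mat_diag_smult mat_diag_power)
  have "suminf (\<lambda>k. ((c \<cdot>\<^sub>m L) ^\<^sub>m k) $$ (i,j) / fact k) =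
      (\<Sum>l<n. P $$ (i,l) * exp (c * f l) * Q $$ (l,j))" if ij: "i < n" "j < n" for i j
  proof (rule sums_unique[symmetric])
    have "(\<lambda>k. \<Sum>l<n. P $$ (i,l) * ((c * f l) ^ k /\<^sub>R fact k) * Q $$ (l,j)) sums
        (\<Sum>l<n. P $$ (i,l) * exp (c * f l) * Q $$ (l,j))"
      by (intro sums_sum sums_mult sums_mult2 exp_converges)
    then show "(\<lambda>k. ((c \<cdot>\<^sub>m L) ^\<^sub>m k) $$ (i,j) / fact k) sums
        (\<Sum>l<n. P $$ (i,l) * exp (c * f l) * Q $$ (l,j))"
      unfolding pow conj_mat_diag_index[OF D(6,7) ij] sum_divide_distrib
      by (simp add: scaleR_conv_of_real divide_inverse mult_ac)
  qed
  then show ?thesis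
    using D(4,6,7) by (intro eq_matI)
      (auto simp: mat_exp_def conj_mat_diag_index simp del: index_mult_mat(1))
qed

text \<open>Eigenvalues are roots of the characteristic polynomial, which is the same for similar
  matrices and splits into linear factors for a diagonal one.\<close>

lemma eigenvalue_similar_diag:
  fixes L :: "'a :: field mat"
  assumes wit: "similar_mat_wit L (mat_diag n f) P Q" and ev: "eigenvalue L z"
  obtains i where "i < n" "z = f i"
proof -
  note L = similar_mat_wit_diag_carrier[OF wit]
  have "similar_mat L (mat_diag n f)" using wit by (auto simp: similar_mat_def)
  from char_poly_similar[OF this]
  have "char_poly L = (\<Prod>a\<leftarrow>diag_mat (mat_diag n f). [:- a, 1:])"
    using char_poly_upper_triangular[OF mat_diag_dim, of n f]
    by (simp add: mat_diag_def upper_triangular_def)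
  then have "poly (\<Prod>a\<leftarrow>diag_mat (mat_diag n f). [:- a, 1:]) z = 0"
    using eigenvalue_root_char_poly[OF L] ev by simp
  then have "z \<in> set (diag_mat (mat_diag n f))"
    by (auto simp: poly_prod_list prod_list_zero_iff)
  then show thesis using that by (auto simp: diag_mat_def mat_diag_def)
qed

lemma complex_root_unity_nome:
  assumes "0 < N" "z ^ N = 1"
  obtains s where "s < N" "z = nome N (of_nat s)"
  using assms complex_roots_unity[of N] by (auto simp: nome_def Suc_le_eq)

text \<open>The eigenvalue exp(2 pi i s/N) has logarithm s/N after division by 2 pi i, and 0 \<le> s
  < N puts it into [0,1). Thus the exponent matrix is diagonal in the same eigenbasis.\<close>

lemma exponent_matrix_finite_order:
  assumes wit: "similar_mat_wit R (mat_diag n (\<lambda>i. nome N (of_nat (s i)))) P Q"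
    and R: "R \<in> carrier_mat n n" and N: "0 < N" and s: "\<And>i. i < n \<Longrightarrow> s i < N"
  defines "L \<equiv> P * mat_diag n (\<lambda>i. of_nat (s i) / of_nat N) * Q"
  shows "exponent_matrix n R L"
    "mat_exp (c \<cdot>\<^sub>m L) = P * mat_diag n (\<lambda>i. exp (c * (of_nat (s i) / of_nat N))) * Q"
proof -
  note D = similar_mat_witD2[OF R wit]
  have L: "L \<in> carrier_mat n n"
    unfolding L_def by (intro mult_carrier_mat[of _ n n] D(6,7) mat_diag_dim)
  have witL: "similar_mat_wit L (mat_diag n (\<lambda>i. of_nat (s i) / of_nat N)) P Q"
    by (rule similar_mat_witI[OF D(1,2) _ L mat_diag_dim D(6,7)]) (simp add: L_def)
  show exp: "mat_exp (c \<cdot>\<^sub>m L) = P * mat_diag n (\<lambda>i. exp (c * (of_nat (s i) / of_nat N))) * Q" for c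
    by (rule mat_exp_similar_diag[OF witL])
  have "0 \<le> Re z \<and> Re z < 1" if "eigenvalue L z" for z
  proof -
    obtain i where i: "i < n" "z = of_nat (s i) / of_nat N"
      using eigenvalue_similar_diag[OF witL \<open>eigenvalue L z\<close>] by blast
    have "z = of_real (real (s i) / real N)" by (simp add: i)
    then have "Re z = real (s i) / real N" by simp
    then show ?thesis using s[OF i(1)] N by simp
  qed
  moreover have "mat_exp ((2 * of_real pi * \<i>) \<cdot>\<^sub>m L) = R"
    unfolding exp using D(3) by (simp add: nome_def)
  ultimately show "exponent_matrix n R L"
    using L by (simp add: exponent_matrix_def)
qed

lemma linear_map_carrier_vec_matrix:
  fixes p :: "'a :: comm_ring_1 vec \<Rightarrow> 'a vec"
  assumes dim: "\<And>v. v \<in> carrier_vec n \<Longrightarrow> p v \<in> carrier_vec m"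
    and add: "\<And>v w. v \<in> carrier_vec n \<Longrightarrow> w \<in> carrier_vec n \<Longrightarrow> p (v + w) = p v + p w"
    and smult: "\<And>c v. v \<in> carrier_vec n \<Longrightarrow> p (c \<cdot>\<^sub>v v) = c \<cdot>\<^sub>v p v"
  obtains M where "M \<in> carrier_mat m n" "\<And>v. v \<in> carrier_vec n \<Longrightarrow> p v = M *\<^sub>v v"
proof
  define M where "M = Matrix.mat m n (\<lambda>(i,j). vec_index (p (unit_vec n j)) i)"
  show M: "M \<in> carrier_mat m n" by (simp add: M_def)
  have z: "0 \<cdot>\<^sub>v x = 0\<^sub>v k" if "x \<in> carrier_vec k" for x :: "'a vec" and k
    using that by (intro eq_vecI) auto
  have "p (0 \<cdot>\<^sub>v 0\<^sub>v n) = 0 \<cdot>\<^sub>v p (0\<^sub>v n)" by (rule smult) simp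
  then have p0: "p (0\<^sub>v n) = 0\<^sub>v m" 
    by (simp only: z[OF zero_carrier_vec] z[OF dim[OF zero_carrier_vec]])
  fix v :: "'a vec" assume v: "v \<in> carrier_vec n"
  \<comment> \<open>\<open>t k\<close> keeps the first \<open>k\<close> coordinates of
    \<open>v\<close>, so that linearity is applied to one unit vector at a time.\<close>
  define t where "t k = Matrix.vec n (\<lambda>i. if i < k then v $ i else 0)" for k
  have tk: "t k \<in> carrier_vec n" for k by (simp add: t_def)
  have "p (t k) = Matrix.vec m (\<lambda>i. \<Sum>j<k. M $$ (i,j) * v $ j)" if "k \<le> n" for k
    using that
  proof (induction k)
    case 0
    have "t 0 = 0\<^sub>v n" by (auto simp: t_def)
    with p0 show ?case by auto
  next
    case (Suc k)
    have "t (Suc k) = t k + v $ k \<cdot>\<^sub>v unit_vec n k"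
      using Suc.prems by (intro eq_vecI) (auto simp: t_def less_Suc_eq)
    then have "p (t (Suc k)) = p (t k) + v $ k \<cdot>\<^sub>v p (unit_vec n k)"
      using tk by (simp add: add smult)
    with Suc show ?case
      using dim[of "unit_vec n k"] by (intro eq_vecI) (auto simp: M_def mult.commute)
  qed
  from this[of n] have "p (t n) = Matrix.vec m (\<lambda>i. \<Sum>j<n. M $$ (i,j) * v $ j)" by simp
  moreover have "t n = v" using v by (auto simp: t_def)
  ultimately show "p v = M *\<^sub>v v"
    using M v by (auto simp: scalar_prod_def atLeast0LessThan)
qed

section \<open>Representations and invariant subspaces\<close>

text \<open>Invertibility follows from multiplicativity: the image of the group inverse is the
  inverse matrix.\<close>

lemma is_repI:
  assumes closed: "\<And>x. x \<in> carrier PSL2Z \<Longrightarrow> \<rho> x \<in> carrier_mat n n"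
    and mult: "\<And>x y. x \<in> carrier PSL2Z \<Longrightarrow> y \<in> carrier PSL2Z \<Longrightarrow> \<rho> (x \<otimes>\<^bsub>PSL2Z\<^esub> y) = \<rho> x * \<rho> y"
    and one: "\<rho> \<one>\<^bsub>PSL2Z\<^esub> = 1\<^sub>m n"
  shows "is_rep n \<rho>"
  unfolding is_rep_def
proof (rule homI)
  interpret group PSL2Z by (rule group_PSL2Z)
  fix x assume x: "x \<in> carrier PSL2Z"
  have "\<rho> (inv\<^bsub>PSL2Z\<^esub> x) * \<rho> x = 1\<^sub>m n" "\<rho> x * \<rho> (inv\<^bsub>PSL2Z\<^esub> x) = 1\<^sub>m n"
    using mult[of "inv\<^bsub>PSL2Z\<^esub> x" x] mult[of x "inv\<^bsub>PSL2Z\<^esub> x"] x one by simp_all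
  with closed[OF x] closed[OF inv_closed[OF x]] show "\<rho> x \<in> carrier (GL n)"
    by (auto simp: GL_def units_of_def Units_def ring_mat_def)
next
  fix x y assume "x \<in> carrier PSL2Z" "y \<in> carrier PSL2Z"
  then show "\<rho> (x \<otimes>\<^bsub>PSL2Z\<^esub> y) = \<rho> x \<otimes>\<^bsub>GL n\<^esub> \<rho> y"
    by (simp add: mult GL_def units_of_def ring_mat_def)
qed

lemma is_rep_carrier_mat: "is_rep n \<rho> \<Longrightarrow> x \<in> carrier PSL2Z \<Longrightarrow> \<rho> x \<in> carrier_mat n n"
  by (auto simp: is_rep_def hom_def GL_def units_of_def Units_def ring_mat_def)

lemma invariant_subspaceD:
  assumes "invariant_subspace n \<rho> W"
  shows "W \<subseteq> carrier_vec n" "0\<^sub>v n \<in> W"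
    "v \<in> W \<Longrightarrow> w \<in> W \<Longrightarrow> v + w \<in> W" "v \<in> W \<Longrightarrow> c \<cdot>\<^sub>v v \<in> W"
    "x \<in> carrier PSL2Z \<Longrightarrow> w \<in> W \<Longrightarrow> \<rho> x *\<^sub>v w \<in> W"
proof -
  have "submodule class_ring W (module_vec TYPE(complex) n)"
    using assms by (simp add: invariant_subspace_def VectorSpace.subspace_def)
  from submodule.subset[OF this] submodule.zero_closed[OF this] submodule.m_closed[OF this]
    submodule.smult_closed[OF this]
  show "W \<subseteq> carrier_vec n" "0\<^sub>v n \<in> W"
    "v \<in> W \<Longrightarrow> w \<in> W \<Longrightarrow> v + w \<in> W" "v \<in> W \<Longrightarrow> c \<cdot>\<^sub>v v \<in> W"
    by (simp_all add: module_vec_simps class_ring_simps)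
  show "x \<in> carrier PSL2Z \<Longrightarrow> w \<in> W \<Longrightarrow> \<rho> x *\<^sub>v w \<in> W"
    using assms by (simp add: invariant_subspace_def)
qed

text \<open>The matrix of the projection onto \<open>W\<close> along \<open>U\<close>, which is well
  defined because the sum is direct.\<close>

lemma complement_projection_matrix:
  fixes U W :: "complex vec set"
  assumes U: "invariant_subspace n \<rho> U" and W: "invariant_subspace n \<rho> W"
    and disj: "U \<inter> W = {0\<^sub>v n}" and sum: "{u + w | u w. u \<in> U \<and> w \<in> W} = carrier_vec n"
  obtains M where "M \<in> carrier_mat n n" "\<And>u. u \<in> U \<Longrightarrow> M *\<^sub>v u = 0\<^sub>v n" "\<And>w. w \<in> W \<Longrightarrow> M *\<^sub>v w = w"
proof -
  note U = invariant_subspaceD[OF U] and W = invariant_subspaceD[OF W]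
  have uniq: "w = w'" if "u \<in> U" "w \<in> W" "u' \<in> U" "w' \<in> W" "u + w = u' + w'" for u w u' w'
  proof -
    have c: "u \<in> carrier_vec n" "w \<in> carrier_vec n" "u' \<in> carrier_vec n" "w' \<in> carrier_vec n"
      using that U(1) W(1) by auto
    have i: "u $ k + w $ k = u' $ k + w' $ k" if "k < n" for k
      using arg_cong[OF \<open>u + w = u' + w'\<close>, of "\<lambda>v. v $ k"] c that by simp
    \<comment> \<open>The difference of two decompositions lies in both subspaces. Subtraction is
      written with the scalar -1 because closure is available for sums and scalar multiples.\<close>
    have "w + (-1) \<cdot>\<^sub>v w' = u' + (-1) \<cdot>\<^sub>v u"
      by (rule eq_vecI) (use c i in \<open>auto simp: algebra_simps\<close>)
    moreover have "w + (-1) \<cdot>\<^sub>v w' \<in> W" "u' + (-1) \<cdot>\<^sub>v u \<in> U" using that U W by auto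
    ultimately have z: "w + (-1) \<cdot>\<^sub>v w' = 0\<^sub>v n" using disj by auto
    show ?thesis
    proof (rule eq_vecI)
      fix k assume "k < dim_vec w'"
      then show "w $ k = w' $ k" using arg_cong[OF z, of "\<lambda>v. v $ k"] c by simp
    qed (use c in auto)
  qed
  define p where "p v = (THE w. w \<in> W \<and> (\<exists>u\<in>U. v = u + w))" for v
  have p: "p (u + w) = w" if "u \<in> U" "w \<in> W" for u w
    unfolding p_def using that uniq by (intro the_equality) blast+
  have decomp: "\<exists>u\<in>U. \<exists>w\<in>W. v = u + w" if "v \<in> carrier_vec n" for v
    using that sum by blast
  obtain M where M: "M \<in> carrier_mat n n" "\<And>v. v \<in> carrier_vec n \<Longrightarrow> p v = M *\<^sub>v v"
  proof (rule linear_map_carrier_vec_matrix[of n p n])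
    fix v :: "complex vec" and c assume "v \<in> carrier_vec n"
    then obtain u w where uw: "u \<in> U" "w \<in> W" "v = u + w" using decomp by blast
    then have c: "u \<in> carrier_vec n" "w \<in> carrier_vec n" using U(1) W(1) by auto
    show "p v \<in> carrier_vec n" using uw p c by simp
    have "c \<cdot>\<^sub>v v = c \<cdot>\<^sub>v u + c \<cdot>\<^sub>v w" using c uw(3) by (simp add: smult_add_distrib_vec)
    then show "p (c \<cdot>\<^sub>v v) = c \<cdot>\<^sub>v p v" using uw p U(4) W(4) by simp
  next
    fix v v' :: "complex vec" assume "v \<in> carrier_vec n" "v' \<in> carrier_vec n"
    then obtain u w u' w' where uw: "u \<in> U" "w \<in> W" "v = u + w" "u' \<in> U" "w' \<in> W" "v' = u' + w'"
      using decomp by metis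
    then have c: "u \<in> carrier_vec n" "w \<in> carrier_vec n" "u' \<in> carrier_vec n" "w' \<in> carrier_vec n"
      using U(1) W(1) by auto
    have "v + v' = (u + u') + (w + w')"
      by (rule eq_vecI) (use c uw in auto)
    then show "p (v + v') = p v + p v'" using uw p U(3) W(3) by simp
  qed blast
  show thesis
  proof (rule that[OF M(1)])
    fix u assume u: "u \<in> U"
    then have "u + 0\<^sub>v n = u" using U(1) by auto
    then show "M *\<^sub>v u = 0\<^sub>v n" using p[OF u W(2)] M(2) u U(1) by auto
  next
    fix w assume w: "w \<in> W"
    then have "0\<^sub>v n + w = w" using W(1) by auto
    then show "M *\<^sub>v w = w" using p[OF U(2) w] M(2) w W(1) by auto
  qed
qed

section \<open>The extension by periods\<close>

lemma mult_mat_vec_index_sum: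
  assumes "M \<in> carrier_mat m n" "v \<in> carrier_vec n" "i < m"
  shows "(M *\<^sub>v v) $ i = (\<Sum>k<n. M $$ (i,k) * v $ k)"
  using assms by (simp add: scalar_prod_def atLeast0LessThan)

text \<open>The integrals enter only as primitives \<open>u\<close> of the forms with power series
  \<open>H\<close> in a common parameter; how they are computed no longer matters from here
  on.\<close>

locale period_extension =
  fixes g N :: nat and f u H :: "nat \<Rightarrow> complex \<Rightarrow> complex" and \<rho>\<^sub>0 :: "int mat set \<Rightarrow> complex mat"
  assumes N_pos: "0 < N"
    and holH: "k < g \<Longrightarrow> H k holomorphic_on ball 0 1"
    and u_eq: "k < g \<Longrightarrow> \<tau> \<in> uhp \<Longrightarrow> u k \<tau> = H k (nome N \<tau>)"
    and u_deriv: "k < g \<Longrightarrow> \<tau> \<in> uhp \<Longrightarrow> (u k has_field_derivative f k \<tau>) (at \<tau>)"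
    and indep: "(\<And>\<tau>. \<tau> \<in> uhp \<Longrightarrow> (\<Sum>k<g. c k * f k \<tau>) = 0) \<Longrightarrow> k < g \<Longrightarrow> c k = 0"
    and rep0: "is_rep g \<rho>\<^sub>0"
    and slash: "A \<in> carrier SL2Z \<Longrightarrow> \<tau> \<in> uhp \<Longrightarrow> k < g \<Longrightarrow>
      slash2 (f k) A \<tau> = (\<Sum>j<g. \<rho>\<^sub>0 (psl A) $$ (k,j) * f j \<tau>)"
begin

section \<open>The vector \<open>F\<close> and the independence of its coordinates\<close>

definition F :: "complex \<Rightarrow> complex vec" where
  "F \<tau> = Matrix.vec (g + 1) (\<lambda>k. if k < g then u k \<tau> else 1)"

lemma F_carrier: "F \<tau> \<in> carrier_vec (g + 1)"
  by (simp add: F_def)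

lemmas F_carrier_Suc [simp] = F_carrier[simplified]

lemma mult_mat_vec_F_index:
  assumes "M \<in> carrier_mat m (g + 1)" "i < m"
  shows "(M *\<^sub>v F \<tau>) $ i = (\<Sum>k<g. M $$ (i,k) * u k \<tau>) + M $$ (i,g)"
  using assms by (simp add: scalar_prod_def F_def atLeast0LessThan)

text \<open>Differentiation turns the relation into one between the forms themselves. Hence the
  \<open>u k\<close> are independent even modulo constants.\<close>

lemma combination_constant_imp_zero:
  assumes const: "\<And>\<tau>. \<tau> \<in> uhp \<Longrightarrow> (\<Sum>k<g. c k * u k \<tau>) = e" and k: "k < g"
  shows "c k = 0"
proof (rule indep[OF _ k])
  fix \<tau> assume \<tau>: "\<tau> \<in> uhp"
  have "((\<lambda>\<tau>. \<Sum>k<g. c k * u k \<tau>) has_field_derivative (\<Sum>k<g. c k * f k \<tau>)) (at \<tau>)"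
    by (intro DERIV_sum DERIV_cmult u_deriv \<tau>) auto
  moreover have "((\<lambda>\<tau>. \<Sum>k<g. c k * u k \<tau>) has_field_derivative 0) (at \<tau>)"
    by (rule has_field_derivative_transform_within_open[OF DERIV_const[of e] open_uhp \<tau>])
      (simp add: const)
  ultimately show "(\<Sum>k<g. c k * f k \<tau>) = 0" by (rule DERIV_unique)
qed

text \<open>Each row of the difference gives a linear relation between the \<open>u k\<close> and 1.
  Matrix identities can therefore be tested on the values of \<open>F\<close>.\<close>

lemma mat_eqI_F:
  assumes M: "M \<in> carrier_mat m (g + 1)" and M': "M' \<in> carrier_mat m (g + 1)"
    and eq: "\<And>\<tau>. \<tau> \<in> uhp \<Longrightarrow> M *\<^sub>v F \<tau> = M' *\<^sub>v F \<tau>"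
  shows "M = M'"
proof (rule eq_matI)
  fix i j assume "i < dim_row M'" "j < dim_col M'"
  with M' have i: "i < m" and j: "j < g + 1" by auto
  have eqi: "(\<Sum>k<g. (M $$ (i,k) - M' $$ (i,k)) * u k \<tau>) = M' $$ (i,g) - M $$ (i,g)"
    if \<tau>: "\<tau> \<in> uhp" for \<tau>
    using arg_cong[OF eq[OF \<tau>], of "\<lambda>v. v $ i"]
    unfolding mult_mat_vec_F_index[OF M i] mult_mat_vec_F_index[OF M' i]
    by (simp add: left_diff_distrib sum_subtractf algebra_simps)
  have 0: "M $$ (i,k) - M' $$ (i,k) = 0" if "k < g" for k
    using combination_constant_imp_zero[OF eqi that] .
  moreover have "M $$ (i,g) = M' $$ (i,g)" using eqi[OF uhp_nonempty] 0 by simp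
  ultimately show "M $$ (i,j) = M' $$ (i,j)" using j by (cases "j = g") auto
qed (use M M' in auto)

section \<open>Periods and the representation they define\<close>

definition period :: "int mat \<Rightarrow> nat \<Rightarrow> complex" where
  "period A k = u k (moebius A \<i>) - (\<Sum>j<g. \<rho>\<^sub>0 (psl A) $$ (k,j) * u j \<i>)"

text \<open>By the chain rule the difference has derivative \<open>slash2 (f k) A\<close> minus its
  expression through \<rho>_0, which is 0. It is therefore constant, and the base point i chosen in
  \<open>period\<close> is immaterial.\<close>

lemma u_moebius:
  assumes A: "A \<in> carrier SL2Z" and \<tau>: "\<tau> \<in> uhp" and k: "k < g"
  shows "u k (moebius A \<tau>) = (\<Sum>j<g. \<rho>\<^sub>0 (psl A) $$ (k,j) * u j \<tau>) + period A k"
proof -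
  let ?v = "\<lambda>\<tau>. u k (moebius A \<tau>) - (\<Sum>j<g. \<rho>\<^sub>0 (psl A) $$ (k,j) * u j \<tau>)"
  have "(?v has_field_derivative 0) (at \<tau>)" if \<tau>: "\<tau> \<in> uhp" for \<tau>
  proof -
    have "((\<lambda>\<tau>. u k (moebius A \<tau>)) has_field_derivative
        f k (moebius A \<tau>) * (1 / (of_int (A $$ (1,0)) * \<tau> + of_int (A $$ (1,1)))\<^sup>2)) (at \<tau>)"
      by (rule DERIV_chain2[OF u_deriv[OF k moebius_uhp[OF A \<tau>]] moebius_has_field_derivative[OF A \<tau>]])
    moreover have "((\<lambda>\<tau>. \<Sum>j<g. \<rho>\<^sub>0 (psl A) $$ (k,j) * u j \<tau>) has_field_derivative
        (\<Sum>j<g. \<rho>\<^sub>0 (psl A) $$ (k,j) * f j \<tau>)) (at \<tau>)"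
      by (intro DERIV_sum DERIV_cmult u_deriv \<tau>) auto
    ultimately have "(?v has_field_derivative
        f k (moebius A \<tau>) * (1 / (of_int (A $$ (1,0)) * \<tau> + of_int (A $$ (1,1)))\<^sup>2) -
        (\<Sum>j<g. \<rho>\<^sub>0 (psl A) $$ (k,j) * f j \<tau>)) (at \<tau>)"
      by (rule DERIV_diff)
    then show ?thesis using slash[OF A \<tau> k] by (simp add: slash2_def)
  qed
  from DERIV_zero_uhp_const[of ?v, OF this \<tau> uhp_nonempty] show ?thesis
    by (simp add: period_def algebra_simps)
qed

text \<open>Periods are defined on matrices while \<rho> takes classes modulo sign. By
  \<open>period_lift\<close> the chosen representative does not affect the period.\<close>

definition lift :: "int mat set \<Rightarrow> int mat" where
  "lift x = (SOME A. A \<in> carrier SL2Z \<and> psl A = x)"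

definition \<rho> :: "int mat set \<Rightarrow> complex mat" where
  "\<rho> x = Matrix.mat (g + 1) (g + 1) (\<lambda>(i, j).
     if i < g then if j < g then \<rho>\<^sub>0 x $$ (i,j) else period (lift x) i
     else if j < g then 0 else 1)"

lemma \<rho>_carrier: "\<rho> x \<in> carrier_mat (g + 1) (g + 1)"
  by (simp add: \<rho>_def)

lemmas \<rho>_carrier_Suc [simp] = \<rho>_carrier[simplified]

lemma lift_psl:
  assumes "A \<in> carrier SL2Z"
  shows "lift (psl A) \<in> carrier SL2Z" "psl (lift (psl A)) = psl A"
  using someI[of "\<lambda>B. B \<in> carrier SL2Z \<and> psl B = psl A" A] assms by (auto simp: lift_def)

lemma period_lift: "A \<in> carrier SL2Z \<Longrightarrow> period (lift (psl A)) k = period A k"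
  using moebius_psl_cong[OF lift_psl(1) _ lift_psl(2), of A] by (simp add: period_def lift_psl)

lemma F_moebius:
  assumes A: "A \<in> carrier SL2Z" and \<tau>: "\<tau> \<in> uhp"
  shows "F (moebius A \<tau>) = \<rho> (psl A) *\<^sub>v F \<tau>"
proof (rule eq_vecI)
  fix i assume "i < dim_vec (\<rho> (psl A) *\<^sub>v F \<tau>)"
  then have i: "i < g + 1" by (simp add: \<rho>_def)
  show "F (moebius A \<tau>) $ i = (\<rho> (psl A) *\<^sub>v F \<tau>) $ i"
    unfolding mult_mat_vec_F_index[OF \<rho>_carrier i]
    using i u_moebius[OF A \<tau>] period_lift[OF A]
    by (cases "i < g") (simp_all add: F_def \<rho>_def)
qed (simp add: F_def \<rho>_def)

text \<open>The cocycle relation for periods need not be computed: both sides send F(\<tau>) to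
  F(AB\<tau>), and the values of \<open>F\<close> determine the matrix.\<close>

lemma \<rho>_mult:
  assumes "x \<in> carrier PSL2Z" "y \<in> carrier PSL2Z"
  shows "\<rho> (x \<otimes>\<^bsub>PSL2Z\<^esub> y) = \<rho> x * \<rho> y"
proof -
  obtain A B where A: "A \<in> carrier SL2Z" "x = psl A" and B: "B \<in> carrier SL2Z" "y = psl B"
    using assms by (auto simp: carrier_PSL2Z)
  show ?thesis
  proof (rule mat_eqI_F)
    fix \<tau> assume \<tau>: "\<tau> \<in> uhp"
    have "\<rho> (psl (A * B)) *\<^sub>v F \<tau> = F (moebius A (moebius B \<tau>))"
      using F_moebius[OF mult_SL2Z[OF A(1) B(1)] \<tau>] moebius_mult[OF A(1) B(1) \<tau>] by simp
    also have "\<dots> = \<rho> x *\<^sub>v (\<rho> y *\<^sub>v F \<tau>)"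
      using F_moebius[OF A(1) moebius_uhp[OF B(1) \<tau>]] F_moebius[OF B(1) \<tau>] A B by simp
    also have "\<dots> = (\<rho> x * \<rho> y) *\<^sub>v F \<tau>"
      by (rule assoc_mult_mat_vec[symmetric, OF \<rho>_carrier \<rho>_carrier F_carrier])
    finally show "\<rho> (x \<otimes>\<^bsub>PSL2Z\<^esub> y) *\<^sub>v F \<tau> = (\<rho> x * \<rho> y) *\<^sub>v F \<tau>"
      using psl_mult[OF A(1) B(1)] A B by simp
  qed (rule \<rho>_carrier mult_carrier_mat[OF \<rho>_carrier \<rho>_carrier])+
qed

lemma \<rho>_one: "\<rho> \<one>\<^bsub>PSL2Z\<^esub> = 1\<^sub>m (g + 1)"
proof (rule mat_eqI_F)
  fix \<tau> assume \<tau>: "\<tau> \<in> uhp"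
  show "\<rho> \<one>\<^bsub>PSL2Z\<^esub> *\<^sub>v F \<tau> = 1\<^sub>m (g + 1) *\<^sub>v F \<tau>"
    using F_moebius[OF one_SL2Z \<tau>] F_carrier by (simp add: psl_one)
qed auto

lemma is_rep_\<rho>: "is_rep (g + 1) \<rho>"
  by (rule is_repI) (auto simp: \<rho>_mult \<rho>_one)

section \<open>The action of the translation and the expansion at the cusp\<close>

lemma F_add_one: "\<tau> \<in> uhp \<Longrightarrow> F (\<tau> + 1) = \<rho> psl_T *\<^sub>v F \<tau>"
  using F_moebius[OF mat_T_SL2Z] by (simp add: moebius_mat_T psl_T_def flip: mat_T_def)

text \<open>The N-th power of the matrix translates the argument of \<open>F\<close> by
  \<open>N\<close>, and \<open>F\<close> has period \<open>N\<close> because \<open>nome N\<close>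
  does.\<close>

lemma \<rho>_T_power: "\<rho> psl_T ^\<^sub>m N = 1\<^sub>m (g + 1)"
proof (rule mat_eqI_F)
  fix \<tau> assume \<tau>: "\<tau> \<in> uhp"
  have \<tau>N: "\<tau> + of_nat N \<in> uhp" using \<tau> by (simp add: uhp_def)
  have "F (\<tau> + of_nat k) = \<rho> psl_T ^\<^sub>m k *\<^sub>v F \<tau>" for k
    using \<tau>
  proof (induction k arbitrary: \<tau>)
    case 0
    show ?case using one_mult_mat_vec[OF F_carrier] carrier_matD(1)[OF \<rho>_carrier[of psl_T]] by simp
  next
    case (Suc k)
    have "\<tau> + 1 \<in> uhp" using Suc.prems by (simp add: uhp_def)
    from Suc.IH[OF this] have "F (\<tau> + of_nat (Suc k)) = \<rho> psl_T ^\<^sub>m k *\<^sub>v (\<rho> psl_T *\<^sub>v F \<tau>)"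
      using F_add_one[OF Suc.prems] by (simp add: add_ac)
    also have "\<dots> = \<rho> psl_T ^\<^sub>m Suc k *\<^sub>v F \<tau>"
      using assoc_mult_mat_vec[OF pow_carrier_mat[OF \<rho>_carrier] \<rho>_carrier F_carrier] by simp
    finally show ?case .
  qed
  moreover have "F (\<tau> + of_nat N) = F \<tau>"
    unfolding F_def using u_eq[OF _ \<tau>] u_eq[OF _ \<tau>N] nome_add_of_nat[OF N_pos, of \<tau>]
    by (intro eq_vecI) auto
  ultimately show "\<rho> psl_T ^\<^sub>m N *\<^sub>v F \<tau> = 1\<^sub>m (g + 1) *\<^sub>v F \<tau>"
    using one_mult_mat_vec[OF F_carrier] by simp
qed (auto intro: pow_carrier_mat)

lemma \<rho>_T_diagonalization:
  obtains P Q s where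
    "similar_mat_wit (\<rho> psl_T) (mat_diag (g + 1) (\<lambda>i. nome N (of_nat (s i)))) P Q"
    "\<And>i. i < g + 1 \<Longrightarrow> s i < N"
proof -
  obtain P Q d where wit: "similar_mat_wit (\<rho> psl_T) (mat_diag (g + 1) d) P Q"
    and d: "\<And>i. i < g + 1 \<Longrightarrow> d i ^ N = 1"
    using finite_order_mat_diagonalization[OF \<rho>_carrier N_pos \<rho>_T_power] by blast
  have "\<forall>i. \<exists>s. i < g + 1 \<longrightarrow> s < N \<and> d i = nome N (of_nat s)"
    using complex_root_unity_nome[OF N_pos d] by metis
  then obtain s where s: "\<And>i. i < g + 1 \<Longrightarrow> s i < N \<and> d i = nome N (of_nat (s i))"
    by metis
  have "mat_diag (g + 1) d = mat_diag (g + 1) (\<lambda>i. nome N (of_nat (s i)))"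
    unfolding mat_diag_def using s by (intro eq_matI) auto
  with wit s show thesis by (intro that[of s P Q]) auto
qed

lemma diagonalizable_\<rho>_T: "diagonalizable_mat (\<rho> psl_T)"
proof -
  obtain P Q s where
    "similar_mat_wit (\<rho> psl_T) (mat_diag (g + 1) (\<lambda>i. nome N (of_nat (s i)))) P Q"
    using \<rho>_T_diagonalization by blast
  moreover have "diagonal_mat (mat_diag n h :: complex mat)" for n h
    by (simp add: diagonal_mat_def mat_diag_def)
  ultimately show ?thesis
    unfolding diagonalizable_mat_def similar_mat_def by blast
qed

text \<open>Extends \<open>H\<close> by the last coordinate 1 of \<open>F\<close>, so that one sum
  over all coordinates expands \<open>M F\<close> in \<open>nome N\<close>.\<close>

definition H' :: "nat \<Rightarrow> complex \<Rightarrow> complex" where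
  "H' k q = (if k < g then H k q else 1)"

lemma holomorphic_H': "H' k holomorphic_on ball 0 1"
  using holH[of k] by (cases "k < g") (simp_all add: H'_def[abs_def])

lemma mult_mat_vec_F_expansion:
  assumes "M \<in> carrier_mat m (g + 1)" "i < m" "\<tau> \<in> uhp"
  shows "(M *\<^sub>v F \<tau>) $ i = (\<Sum>k<g + 1. M $$ (i,k) * H' k (nome N \<tau>))"
  unfolding mult_mat_vec_F_index[OF assms(1,2)] using assms(3)
  by (simp add: H'_def u_eq cong: sum.cong_simp)

text \<open>In an eigenbasis of \<rho>(T) the i-th coordinate of \<open>F\<close> is q^(s/N) times a
  power series in q, with s = \<open>s i\<close>. The exponential of -2 pi i \<tau> L removes
  exactly these factors, and \<open>P\<close> returns to the original coordinates.\<close>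

lemma holomorphic_at_cusp_F: "holomorphic_at_cusp (g + 1) \<rho> F"
proof -
  let ?n = "g + 1"
  obtain P Q s where
    wit: "similar_mat_wit (\<rho> psl_T) (mat_diag ?n (\<lambda>i. nome N (of_nat (s i)))) P Q"
    and s: "\<And>i. i < ?n \<Longrightarrow> s i < N"
    by (rule \<rho>_T_diagonalization) (rule that)
  let ?D = "mat_diag ?n (\<lambda>i. nome N (of_nat (s i)))"
  note D = similar_mat_witD2[OF \<rho>_carrier wit]
  define L where "L = P * mat_diag ?n (\<lambda>i. of_nat (s i) / of_nat N) * Q"
  note L = exponent_matrix_finite_order[OF wit \<rho>_carrier N_pos s, folded L_def]
  \<comment> \<open>The coordinates of \<open>F\<close> in the eigenbasis, as power series in the
    parameter \<open>nome N\<close>.\<close>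
  define E where "E i q = (\<Sum>k<?n. Q $$ (i,k) * H' k q)" for i q
  have QF: "(Q *\<^sub>v F \<tau>) $ i = E i (nome N \<tau>)" if "i < ?n" "\<tau> \<in> uhp" for i \<tau>
    using mult_mat_vec_F_expansion[OF D(7) that] by (simp add: E_def)
  have diag_index: "(mat_diag ?n h *\<^sub>v v) $ i = h i * v $ i"
    if "i < ?n" "v \<in> carrier_vec ?n" for i v and h :: "nat \<Rightarrow> complex"
    using that by (simp add: mat_diag_def scalar_prod_def if_distrib[of "\<lambda>x. x * _"] cong: if_cong)
  have "\<exists>K. K holomorphic_on ball 0 1 \<and>
      (\<forall>\<tau>\<in>uhp. E i (nome N \<tau>) = nome N (of_nat (s i) * \<tau>) * K (nome 1 \<tau>))" if i: "i < ?n" for i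
  proof -
    have "E i holomorphic_on ball 0 1"
      unfolding E_def[abs_def] by (intro holomorphic_intros holomorphic_H')
    moreover have "E i (nome N (\<tau> + 1)) = nome N (of_nat (s i)) * E i (nome N \<tau>)"
      if \<tau>: "\<tau> \<in> uhp" for \<tau>
    proof -
      have "\<tau> + 1 \<in> uhp" using \<tau> by (simp add: uhp_def)
      have "Q * \<rho> psl_T = ?D * Q"
      proof -
        have "Q * \<rho> psl_T = Q * (P * (?D * Q))"
          using D(3) assoc_mult_mat[OF D(6) mat_diag_dim D(7)] by simp
        also have "\<dots> = (Q * P) * (?D * Q)"
          by (rule assoc_mult_mat[symmetric, OF D(7,6) mult_carrier_mat[OF mat_diag_dim D(7)]])
        also have "\<dots> = ?D * Q"
          unfolding D(2) by (rule left_mult_one_mat[OF mult_carrier_mat[OF mat_diag_dim D(7)]])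
        finally show ?thesis .
      qed
      then have "Q *\<^sub>v F (\<tau> + 1) = ?D *\<^sub>v (Q *\<^sub>v F \<tau>)"
        unfolding F_add_one[OF \<tau>] assoc_mult_mat_vec[OF D(7) \<rho>_carrier F_carrier, symmetric]
        using assoc_mult_mat_vec[OF mat_diag_dim D(7) F_carrier] by simp
      then have "(Q *\<^sub>v F (\<tau> + 1)) $ i = nome N (of_nat (s i)) * (Q *\<^sub>v F \<tau>) $ i"
        using diag_index[OF i mult_mat_vec_carrier[OF D(7) F_carrier]] by simp
      then show ?thesis using QF[OF i] \<tau> \<open>\<tau> + 1 \<in> uhp\<close> by simp
    qed
    ultimately show ?thesis
      using equivariant_power_series_factor[OF N_pos s[OF i]] by metis
  qed
  then obtain K where holK: "\<And>i. i < ?n \<Longrightarrow> K i holomorphic_on ball 0 1"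
    and K: "\<And>i \<tau>. i < ?n \<Longrightarrow> \<tau> \<in> uhp \<Longrightarrow>
      E i (nome N \<tau>) = nome N (of_nat (s i) * \<tau>) * K i (nome 1 \<tau>)"
    by metis
  have exp_F: "(mat_exp ((- (2 * of_real pi * \<i> * \<tau>)) \<cdot>\<^sub>m L) *\<^sub>v F \<tau>) $ a =
      (\<Sum>i<?n. P $$ (a,i) * K i (exp (2 * of_real pi * \<i> * \<tau>)))" if a: "a < ?n" and \<tau>: "\<tau> \<in> uhp" for a \<tau>
  proof -
    \<comment> \<open>The reciprocal of the fractional power q^(s/N) found in
      \<open>K\<close>.\<close>
    define h where "h i = exp (- (2 * of_real pi * \<i> * \<tau>) * (of_nat (s i) / of_nat N))" for i
    have hn: "h i * nome N (of_nat (s i) * \<tau>) = 1" for i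
      unfolding h_def nome_def exp_add[symmetric] by (simp add: mult_ac)
    have carr: "mat_diag ?n h * Q \<in> carrier_mat ?n ?n" by (rule mult_carrier_mat[OF mat_diag_dim D(7)])
    have comp: "(mat_diag ?n h *\<^sub>v (Q *\<^sub>v F \<tau>)) $ i = K i (nome 1 \<tau>)" if i: "i < ?n" for i
    proof -
      have "(mat_diag ?n h *\<^sub>v (Q *\<^sub>v F \<tau>)) $ i = h i * (nome N (of_nat (s i) * \<tau>) * K i (nome 1 \<tau>))"
        using diag_index[OF i mult_mat_vec_carrier[OF D(7) F_carrier]] QF[OF i \<tau>] K[OF i \<tau>] by simp
      then show ?thesis using hn[of i] by (simp flip: mult.assoc)
    qed
    have "mat_exp ((- (2 * of_real pi * \<i> * \<tau>)) \<cdot>\<^sub>m L) = P * mat_diag ?n h * Q"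
      unfolding h_def by (rule L(2))
    also have "\<dots> = P * (mat_diag ?n h * Q)" by (rule assoc_mult_mat[OF D(6) mat_diag_dim D(7)])
    finally have "mat_exp ((- (2 * of_real pi * \<i> * \<tau>)) \<cdot>\<^sub>m L) *\<^sub>v F \<tau> =
        P *\<^sub>v (mat_diag ?n h *\<^sub>v (Q *\<^sub>v F \<tau>))"
      using assoc_mult_mat_vec[OF D(6) carr F_carrier] assoc_mult_mat_vec[OF mat_diag_dim D(7) F_carrier]
      by simp
    also have "\<dots> $ a = (\<Sum>i<?n. P $$ (a,i) * (mat_diag ?n h *\<^sub>v (Q *\<^sub>v F \<tau>)) $ i)"
      by (rule mult_mat_vec_index_sum[OF D(6) mult_mat_vec_carrier[OF mat_diag_dim
            mult_mat_vec_carrier[OF D(7) F_carrier]] a])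
    also have "\<dots> = (\<Sum>i<?n. P $$ (a,i) * K i (nome 1 \<tau>))"
      by (rule sum.cong) (simp_all only: comp lessThan_iff)
    finally show ?thesis by (simp add: nome_def)
  qed
  show ?thesis
    unfolding holomorphic_at_cusp_def
  proof (intro exI[of _ L] conjI L(1) allI impI)
    fix a assume a: "a < ?n"
    have "(\<lambda>q. \<Sum>i<?n. P $$ (a,i) * K i q) holomorphic_on ball 0 1"
      by (intro holomorphic_intros holK) auto
    with exp_F[OF a] show "\<exists>h. h holomorphic_on ball 0 1 \<and>
        (\<forall>\<tau>\<in>uhp. h (exp (2 * of_real pi * \<i> * \<tau>)) =
          (mat_exp ((- (2 * of_real pi * \<i> * \<tau>)) \<cdot>\<^sub>m L) *\<^sub>v F \<tau>) $ a)"
      by (intro exI[of _ "\<lambda>q. \<Sum>i<?n. P $$ (a,i) * K i q"] conjI ballI) (simp_all only:)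
  qed
qed

lemma holomorphic_vvmf_F: "holomorphic_vvmf (g + 1) \<rho> F"
proof -
  have "(\<lambda>\<tau>. F \<tau> $ i) holomorphic_on uhp" if "i < g + 1" for i
  proof (cases "i < g")
    case True
    then show ?thesis
      using u_deriv[OF True] by (auto simp: F_def holomorphic_on_open[OF open_uhp])
  qed (use that in \<open>simp add: F_def\<close>)
  then show ?thesis
    by (simp add: holomorphic_vvmf_def F_moebius holomorphic_at_cusp_F[simplified])
qed

section \<open>The exact sequence read off from the block triangular form\<close>

lemma short_exact_\<rho>: "short_exact g \<rho>\<^sub>0 (incl_first g) (g + 1) \<rho> (proj_last g) 1 trivial_rep"
proof -
  have I: "incl_first g \<in> carrier_mat (g + 1) g" and P: "proj_last g \<in> carrier_mat 1 (g + 1)"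
    by (simp_all add: incl_first_def proj_last_def)
  have Iv: "incl_first g *\<^sub>v v = Matrix.vec (g + 1) (\<lambda>i. if i < g then v $ i else 0)"
    if "v \<in> carrier_vec g" for v
    using that by (intro eq_vecI)
      (auto simp: incl_first_def scalar_prod_def if_distrib[of "\<lambda>x. x * _"] cong: if_cong)
  have Pv: "proj_last g *\<^sub>v v = Matrix.vec 1 (\<lambda>_. v $ g)" if "v \<in> carrier_vec (g + 1)" for v
    using that by (intro eq_vecI)
      (auto simp: proj_last_def scalar_prod_def if_distrib[of "\<lambda>x. x * _"] cong: if_cong)
  have "incl_first g * \<rho>\<^sub>0 x = \<rho> x * incl_first g" if x: "x \<in> carrier PSL2Z" for x
    using is_rep_carrier_mat[OF rep0 x]
    by (intro eq_matI) (auto simp: incl_first_def \<rho>_def scalar_prod_def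
        if_distrib[of "\<lambda>x. x * _"] if_distrib[of "\<lambda>x. _ * x"] cong: if_cong)
  moreover have "proj_last g * \<rho> x = trivial_rep x * proj_last g" for x
    by (intro eq_matI) (auto simp: proj_last_def \<rho>_def trivial_rep_def scalar_prod_def
        if_distrib[of "\<lambda>x. x * _"] if_distrib[of "\<lambda>x. _ * x"] cong: if_cong)
  moreover have "inj_on ((*\<^sub>v) (incl_first g)) (carrier_vec g)"
  proof (rule inj_onI)
    fix v w :: "complex vec"
    assume vw: "v \<in> carrier_vec g" "w \<in> carrier_vec g" "incl_first g *\<^sub>v v = incl_first g *\<^sub>v w"
    show "v = w"
    proof (rule eq_vecI)
      fix i assume "i < dim_vec w"
      moreover have "(incl_first g *\<^sub>v v) $ i = (incl_first g *\<^sub>v w) $ i" by (simp only: vw(3))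
      ultimately show "v $ i = w $ i" using vw(1,2) by (simp add: Iv)
    qed (use vw in auto)
  qed
  moreover have "(*\<^sub>v) (incl_first g) ` carrier_vec g = mat_kernel (proj_last g)"
  proof (intro equalityI subsetI)
    fix v assume "v \<in> (*\<^sub>v) (incl_first g) ` carrier_vec g"
    then show "v \<in> mat_kernel (proj_last g)"
      using P by (auto simp: Iv Pv mat_kernel)
  next
    fix v assume "v \<in> mat_kernel (proj_last g)"
    then have v: "v \<in> carrier_vec (g + 1)" and "proj_last g *\<^sub>v v = 0\<^sub>v 1"
      using P by (auto simp: mat_kernel)
    then have "Matrix.vec 1 (\<lambda>_. v $ g) $ 0 = 0\<^sub>v 1 $ 0" by (simp only: Pv)
    then have "v $ g = 0" by simp
    with v have "v = incl_first g *\<^sub>v Matrix.vec g (\<lambda>i. v $ i)"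
      by (intro eq_vecI) (auto simp: Iv less_Suc_eq)
    then show "v \<in> (*\<^sub>v) (incl_first g) ` carrier_vec g" by (rule image_eqI) simp
  qed
  moreover have "(*\<^sub>v) (proj_last g) ` carrier_vec (g + 1) = carrier_vec 1"
  proof (intro equalityI subsetI)
    fix w :: "complex vec" assume w: "w \<in> carrier_vec 1"
    then have "w = proj_last g *\<^sub>v Matrix.vec (g + 1) (\<lambda>_. w $ 0)"
      by (intro eq_vecI) (auto simp: Pv)
    then show "w \<in> (*\<^sub>v) (proj_last g) ` carrier_vec (g + 1)" by (rule image_eqI) simp
  qed (auto simp: Pv)
  ultimately show ?thesis
    using I P by (simp add: short_exact_def intertwines_def)
qed

section \<open>Indecomposability for a normal subgroup of finite index\<close>

context
  fixes G :: "int mat set set"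
  assumes normal: "G \<lhd> PSL2Z" and finite_index: "finite (rcosets\<^bsub>PSL2Z\<^esub> G)"
    and trivial_on_G: "\<And>x. x \<in> G \<Longrightarrow> \<rho>\<^sub>0 x = 1\<^sub>m g"
begin

text \<open>The upper left block is the identity on \<open>G\<close>, so only the last column moves
  a vector, in proportion to its last coordinate.\<close>

lemma \<rho>_eq_unipotent:
  assumes x: "x \<in> G" and v: "v \<in> carrier_vec (g + 1)"
  shows "\<rho> x *\<^sub>v v = v + v $ g \<cdot>\<^sub>v Matrix.vec (g + 1) (\<lambda>i. if i < g then period (lift x) i else 0)"
  using v by (intro eq_vecI)
    (auto simp: \<rho>_def scalar_prod_def trivial_on_G[OF x] mult.commute less_Suc_eq
      if_distrib[of "\<lambda>x. x * _"] if_distrib[of "\<lambda>x. _ * x"] cong: if_cong)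

text \<open>For \<open>y \<in> G\<close> the vector \<open>\<rho> y x - x\<close> of \<open>U\<close> is a nonzero multiple of the period vector of \<open>y\<close>,
  so \<open>M\<close> kills all periods and \<open>M F\<close> is invariant under \<open>G\<close>.\<close>

lemma invariant_functional_zero:
  fixes U :: "complex vec set" and x :: "complex vec"
  assumes U: "invariant_subspace (g + 1) \<rho> U" and x: "x \<in> U" "x $ g \<noteq> 0"
    and M: "M \<in> carrier_mat (g + 1) (g + 1)" and MU: "\<And>v. v \<in> U \<Longrightarrow> M *\<^sub>v v = 0\<^sub>v (g + 1)"
  shows "M = 0\<^sub>m (g + 1) (g + 1)"
proof -
  let ?n = "g + 1"
  note U = invariant_subspaceD[OF U]
  interpret normal G PSL2Z by (rule normal)
  obtain R where R: "finite R" "R \<subseteq> carrier SL2Z" and cover: "\<And>A. A \<in> carrier SL2Z \<Longrightarrow>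
      \<exists>B\<in>R. \<exists>D\<in>carrier SL2Z. psl D \<in> G \<and> (\<forall>\<tau>\<in>uhp. moebius B \<tau> = moebius D (moebius A \<tau>))"
    using finite_coset_representatives[OF normal finite_index] by metis
  have inv: "M *\<^sub>v (\<rho> y *\<^sub>v v) = M *\<^sub>v v" if y: "y \<in> G" and v: "v \<in> carrier_vec ?n" for y v
  proof -
    let ?p = "Matrix.vec ?n (\<lambda>i. if i < g then period (lift y) i else 0)"
    have xc: "x \<in> carrier_vec ?n" using x U(1) by auto
    have "\<rho> y *\<^sub>v x + (-1) \<cdot>\<^sub>v x \<in> U"
      using U(3,4,5) x(1) y subset by blast
    moreover have "\<rho> y *\<^sub>v x + (-1) \<cdot>\<^sub>v x = x $ g \<cdot>\<^sub>v ?p"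
      unfolding \<rho>_eq_unipotent[OF y xc] using xc by (intro eq_vecI) auto
    ultimately have "(1 / x $ g) \<cdot>\<^sub>v (x $ g \<cdot>\<^sub>v ?p) \<in> U" using U(4) by simp
    moreover have "(1 / x $ g) \<cdot>\<^sub>v (x $ g \<cdot>\<^sub>v ?p) = ?p" using x(2) by (intro eq_vecI) auto
    ultimately have "M *\<^sub>v ?p = 0\<^sub>v ?n" using MU by simp
    then have "M *\<^sub>v (v + v $ g \<cdot>\<^sub>v ?p) = M *\<^sub>v v + v $ g \<cdot>\<^sub>v 0\<^sub>v ?n"
      using v by (simp add: mult_add_distrib_mat_vec[OF M] mult_mat_vec[OF M])
    also have "\<dots> = M *\<^sub>v v" using M by (intro eq_vecI) auto
    finally have "M *\<^sub>v (v + v $ g \<cdot>\<^sub>v ?p) = M *\<^sub>v v" .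
    then show ?thesis by (simp add: \<rho>_eq_unipotent[OF y v])
  qed
  have M0: "M $$ (i,j) = 0" if i: "i < ?n" and j: "j < g" for i j
  proof -
    let ?v = "\<lambda>\<tau>. (M *\<^sub>v F \<tau>) $ i"
    \<comment> \<open>The expansion in \<open>nome N\<close> of the i-th coordinate of
      \<open>M F\<close> after translation by \<open>B\<close>; its coefficients are row
      \<open>i\<close> of \<open>M \<rho>(B)\<close>.\<close>
    let ?K = "\<lambda>B q. \<Sum>k<?n. (M * \<rho> (psl B)) $$ (i,k) * H' k q"
    have Mc: "M * \<rho> (psl B) \<in> carrier_mat ?n ?n" for B by (rule mult_carrier_mat[OF M \<rho>_carrier])
    obtain c where c: "\<And>\<tau>. \<tau> \<in> uhp \<Longrightarrow> ?v \<tau> = c"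
    proof (rule finite_translates_imp_constant[OF N_pos R, of ?K ?v])
      fix B assume "B \<in> R"
      show "?K B holomorphic_on ball 0 1" by (intro holomorphic_intros holomorphic_H')
    next
      fix B \<tau> assume B: "B \<in> R" and \<tau>: "\<tau> \<in> uhp"
      have "B \<in> carrier SL2Z" using B R(2) by blast
      then have "M *\<^sub>v F (moebius B \<tau>) = (M * \<rho> (psl B)) *\<^sub>v F \<tau>"
        using F_moebius \<tau> assoc_mult_mat_vec[OF M \<rho>_carrier F_carrier] by simp
      then show "?v (moebius B \<tau>) = ?K B (nome N \<tau>)"
        using mult_mat_vec_F_expansion[OF Mc i \<tau>] by simp
    next
      fix A assume A: "A \<in> carrier SL2Z"
      then obtain B D where B: "B \<in> R" and D: "D \<in> carrier SL2Z" "psl D \<in> G"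
        and BD: "\<forall>\<tau>\<in>uhp. moebius B \<tau> = moebius D (moebius A \<tau>)"
        using cover by blast
      \<comment> \<open>The two points differ by an element of \<open>G\<close>, under which
        \<open>M F\<close> is invariant.\<close>
      have "?v (moebius A \<tau>) = ?v (moebius B \<tau>)" if \<tau>: "\<tau> \<in> uhp" for \<tau>
        using BD \<tau> F_moebius[OF D(1) moebius_uhp[OF A \<tau>]] inv[OF D(2) F_carrier] by simp
      with B show "\<exists>B\<in>R. \<forall>\<tau>\<in>uhp. ?v (moebius A \<tau>) = ?v (moebius B \<tau>)" by blast
    qed blast
    have "(\<Sum>k<g. M $$ (i,k) * u k \<tau>) = c - M $$ (i,g)" if \<tau>: "\<tau> \<in> uhp" for \<tau>
      using c[OF \<tau>] mult_mat_vec_F_index[OF M i, of \<tau>] by (simp add: eq_diff_eq)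
    from combination_constant_imp_zero[OF this j] show ?thesis .
  qed
  \<comment> \<open>Independence says nothing about the constant coordinate. Its column is handled
    by the vector \<open>x\<close> of \<open>U\<close>, which \<open>M\<close> kills and whose last
    coordinate is nonzero.\<close>
  have Mg: "M $$ (i,g) = 0" if i: "i < ?n" for i
  proof -
    have "(M *\<^sub>v x) $ i = 0" using MU[OF x(1)] i by simp
    moreover have "(M *\<^sub>v x) $ i = M $$ (i,g) * x $ g"
      using M i x U(1) M0[OF i] by (auto simp: scalar_prod_def)
    ultimately show ?thesis using x(2) by simp
  qed
  show ?thesis
    using M M0 Mg by (intro eq_matI) (auto simp: less_Suc_eq)
qed

text \<open>Decomposing the last unit vector shows that one summand contains a vector with nonzero
  last coordinate. The projection onto the other summand kills the first one, so it is zero by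
  \<open>invariant_functional_zero\<close>, and the other summand vanishes.\<close>

lemma indecomposable_\<rho>: "indecomposable (g + 1) \<rho>"
proof -
  let ?n = "g + 1"
  have key: False if U: "invariant_subspace ?n \<rho> U" and W: "invariant_subspace ?n \<rho> W"
    and W0: "W \<noteq> {0\<^sub>v ?n}" and disj: "U \<inter> W = {0\<^sub>v ?n}"
    and sum: "{u + w | u w. u \<in> U \<and> w \<in> W} = carrier_vec ?n"
    and x: "x \<in> U" "x $ g \<noteq> 0" for U W and x :: "complex vec"
  proof -
    obtain M where M: "M \<in> carrier_mat ?n ?n" "\<And>v. v \<in> U \<Longrightarrow> M *\<^sub>v v = 0\<^sub>v ?n"
      "\<And>w. w \<in> W \<Longrightarrow> M *\<^sub>v w = w"
      using complement_projection_matrix[OF U W disj sum] by blast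
    have "M = 0\<^sub>m ?n ?n" by (rule invariant_functional_zero[OF U x M(1,2)])
    then have "w = 0\<^sub>v ?n" if w: "w \<in> W" for w
    proof -
      have "0\<^sub>m ?n ?n *\<^sub>v w = 0\<^sub>v ?n"
        using invariant_subspaceD(1)[OF W] w by (intro eq_vecI) auto
      then show ?thesis using M(3)[OF w] \<open>M = 0\<^sub>m ?n ?n\<close> by simp
    qed
    with W0 invariant_subspaceD(2)[OF W] show False by blast
  qed
  have False if U: "invariant_subspace ?n \<rho> U" and W: "invariant_subspace ?n \<rho> W"
    and U0: "U \<noteq> {0\<^sub>v ?n}" and W0: "W \<noteq> {0\<^sub>v ?n}" and disj: "U \<inter> W = {0\<^sub>v ?n}"
    and sum: "{u + w | u w. u \<in> U \<and> w \<in> W} = carrier_vec ?n" for U W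
  proof -
    have "unit_vec ?n g \<in> carrier_vec ?n" by simp
    then have "unit_vec ?n g \<in> {u + w | u w. u \<in> U \<and> w \<in> W}" by (simp only: sum)
    then obtain a b where ab: "a \<in> U" "b \<in> W" "unit_vec ?n g = a + b" by blast
    have c: "a \<in> carrier_vec ?n" "b \<in> carrier_vec ?n"
      using ab invariant_subspaceD(1)[OF U] invariant_subspaceD(1)[OF W] by auto
    have "a $ g + b $ g = 1" using arg_cong[OF ab(3), of "\<lambda>v. v $ g"] c by simp
    then consider "a $ g \<noteq> 0" | "b $ g \<noteq> 0" by fastforce
    then show False
    proof cases
      case 1
      then show False using key[OF U W W0 disj sum ab(1)] by blast
    next
      \<comment> \<open>The argument is symmetric, with the roles of \<open>U\<close> and
        \<open>W\<close> exchanged.\<close>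
      case 2
      have "{w + u | w u. w \<in> W \<and> u \<in> U} = {u + w | u w. u \<in> U \<and> w \<in> W}"
        using invariant_subspaceD(1)[OF U] invariant_subspaceD(1)[OF W]
        by (auto simp: subset_iff) (metis comm_add_vec)+
      then show False using key[OF W U U0 _ _ ab(2) 2] disj sum by (simp add: Int_commute)
    qed
  qed
  then show ?thesis by (auto simp: indecomposable_def)
qed

end

end

theorem theorem5p2:
  fixes G :: "int mat set set" and g :: nat
    and f :: "nat \<Rightarrow> complex \<Rightarrow> complex"
    and \<rho>\<^sub>0 :: "int mat set \<Rightarrow> complex mat"
  assumes "G \<lhd> PSL2Z"
    and "finite (rcosets\<^bsub>PSL2Z\<^esub> G)"
    and "has_genus (modular_curve G) g"
    and "cusp_form2_basis G g f"
    and "is_rep g \<rho>\<^sub>0"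
    and "\<forall>A\<in>carrier SL2Z. \<forall>\<tau>\<in>uhp.
           Matrix.vec g (\<lambda>k. slash2 (f k) A \<tau>) = \<rho>\<^sub>0 (psl A) *\<^sub>v Matrix.vec g (\<lambda>k. f k \<tau>)"
  shows "\<exists>\<rho>. is_rep (g + 1) \<rho> \<and>
           holomorphic_vvmf (g + 1) \<rho>
             (\<lambda>\<tau>. Matrix.vec (g + 1) (\<lambda>k. if k < g then integral_from_cusp (f k) \<tau> else 1)) \<and>
           indecomposable (g + 1) \<rho> \<and>
           short_exact g \<rho>\<^sub>0 (incl_first g) (g + 1) \<rho> (proj_last g) 1 trivial_rep \<and>
           diagonalizable_mat (\<rho> psl_T)"
proof -
  have cusp: "\<And>k. k < g \<Longrightarrow> cusp_form2 G (f k)"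
    and indep: "\<And>c k. (\<And>\<tau>. \<tau> \<in> uhp \<Longrightarrow> (\<Sum>k<g. c k * f k \<tau>) = 0) \<Longrightarrow> k < g \<Longrightarrow> c k = 0"
    using assms(4) by (auto simp: cusp_form2_basis_def)
  have carr0: "\<rho>\<^sub>0 (psl A) \<in> carrier_mat g g" if "A \<in> carrier SL2Z" for A
    by (rule is_rep_carrier_mat[OF assms(5) psl_closed[OF that]])
  have slash: "slash2 (f k) A \<tau> = (\<Sum>j<g. \<rho>\<^sub>0 (psl A) $$ (k,j) * f j \<tau>)"
    if "A \<in> carrier SL2Z" "\<tau> \<in> uhp" "k < g" for A \<tau> k
    using arg_cong[OF assms(6)[rule_format, OF that(1,2)], of "\<lambda>v. v $ k"] carr0[OF that(1)] that(3)
    by (simp add: scalar_prod_def atLeast0LessThan)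
  obtain N H where NH: "0 < N" "\<And>k. k < g \<Longrightarrow> H k holomorphic_on ball 0 1"
    "\<And>k \<tau>. k < g \<Longrightarrow> \<tau> \<in> uhp \<Longrightarrow> integral_from_cusp (f k) \<tau> = H k (nome N \<tau>)"
    "\<And>k \<tau>. k < g \<Longrightarrow> \<tau> \<in> uhp \<Longrightarrow> (integral_from_cusp (f k) has_field_derivative f k \<tau>) (at \<tau>)"
    by (rule common_period_expansion[of g G f, OF cusp]) (assumption, rule that)
  interpret period_extension g N f "\<lambda>k. integral_from_cusp (f k)" H \<rho>\<^sub>0
    by (rule period_extension.intro; rule NH indep assms(5) slash; assumption)
  \<comment> \<open>Elements of \<open>G\<close> fix every form, and the independence of the basis
    then forces the matrix to be the identity.\<close>
  have "\<rho>\<^sub>0 x = 1\<^sub>m g" if x: "x \<in> G" for x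
  proof -
    have "x \<in> carrier PSL2Z" using x assms(1) normal.axioms(1) subgroup.subset by blast
    then obtain A where A: "A \<in> carrier SL2Z" "x = psl A" by (auto simp: carrier_PSL2Z)
    show ?thesis
    proof (rule eq_matI)
      fix i j assume "i < dim_row (1\<^sub>m g :: complex mat)" "j < dim_col (1\<^sub>m g :: complex mat)"
      then have i: "i < g" and j: "j < g" by auto
      have "(\<Sum>k<g. (\<rho>\<^sub>0 x $$ (i,k) - 1\<^sub>m g $$ (i,k)) * f k \<tau>) = 0" if \<tau>: "\<tau> \<in> uhp" for \<tau>
      proof -
        have "slash2 (f i) A \<tau> = f i \<tau>" using cusp[OF i] A x \<tau> by (auto simp: cusp_form2_def)
        moreover have "(\<Sum>k<g. 1\<^sub>m g $$ (i,k) * f k \<tau>) = f i \<tau>"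
          using i by (simp add: if_distrib[of "\<lambda>x. x * _"] cong: if_cong)
        ultimately show ?thesis
          using slash[OF A(1) \<tau> i] A(2) by (simp add: left_diff_distrib sum_subtractf)
      qed
      from indep[OF this j] show "\<rho>\<^sub>0 x $$ (i,j) = 1\<^sub>m g $$ (i,j)" by simp
    qed (use carr0[OF A(1)] A(2) in auto)
  qed
  from indecomposable_\<rho>[OF assms(1,2) this] show ?thesis
    using is_rep_\<rho> holomorphic_vvmf_F[unfolded F_def[abs_def]] short_exact_\<rho> diagonalizable_\<rho>_T
    by blast
qed

end
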